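(* Let $\Omega$ be a bounded pseudoconvex domain in $\mathbb{C}^n$ with Hölder boundary, and let $d(z)$ denote the Euclidean distance from $z\in\Omega$ to $\partial\Omega$. Then for some $\tau>0$ there exist a continuous plurisubharmonic function $w$ on $\Omega$ and constants $M_1, M_2>0$ such that, for all $z\in\Omega$, $$-\frac{M_1}{(-\log d(z))^{\tau}}\cdot\frac{1}{\log(-\log d(z))}\ \leq\ w(z)\ \leq\ -\frac{M_2}{(-\log d(z))^{\tau}}\cdot\frac{1}{\log(-\log d(z))}.$$
   Context: A domain $\Omega\subset\mathbb{C}^n$ has Hölder boundary if locally $\partial\Omega$ can be written as the graph of a Hölder continuous function under certain holomorphic coordinates. That is, near each boundary point $p$ there are local holomorphic coordinates $z=(z',z_n)$, $z'=(z_1,\dots,z_{n-1})$, in which $p=0$ and, for some $r>0$, the part of $\Omega$ in the ball $B(0,r)$ is $\{z\in B(0,r) : \operatorname{Im} z_n<g(z',\operatorname{Re} z_n)\}$, where $g$ is a function on $\{(z',x_n)\in\mathbb{C}^{n-1}\times\mathbb{R} : |z'|^2+x_n^2<r^2\}$ that is Hölder continuous with some exponent $\beta\in(0,1)$ and satisfies $g(0',0)=0$.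
   Formalization: The bound is undefined at d(z)=1/e and tends to −∞ as d(z) increases to 1/e, so it fails if d reaches 1/e in Ω. It is proved for all z with d(z)≤δ, for every δ<1/e, with one w and τ but M_1, M_2 depending on δ; if d<1/e on Ω this covers all z. *)

theory Defs
  imports "HOL-Analysis.Analysis"
begin

text \<open>
  The space of \<open>n\<close> complex variables is \<^typ>\<open>complex^'n\<close>; its norm is the Euclidean one.
  A map is holomorphic if it has a complex linear Frechet derivative at each point.
\<close>

definition holomorphic_map :: "(complex^'n) set \<Rightarrow> (complex^'n \<Rightarrow> complex^'m) \<Rightarrow> bool" where
  "holomorphic_map U F \<longleftrightarrow>
     (\<forall>x\<in>U. \<exists>D. (F has_derivative D) (at x) \<and> (\<forall>c v. D (c *s v) = c *s D v))"

definition biholomorphic_map ::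
  "(complex^'n) set \<Rightarrow> (complex^'n) set \<Rightarrow> (complex^'n \<Rightarrow> complex^'n) \<Rightarrow> bool" where
  "biholomorphic_map U V F \<longleftrightarrow>
     open U \<and> open V \<and> bij_betw F U V \<and>
     holomorphic_map U F \<and> holomorphic_map V (inv_into U F)"

definition Hoelder_on :: "real \<Rightarrow> ('a::metric_space) set \<Rightarrow> ('a \<Rightarrow> real) \<Rightarrow> bool" where
  "Hoelder_on \<beta> X g \<longleftrightarrow> (\<exists>C. \<forall>x\<in>X. \<forall>y\<in>X. \<bar>g x - g y\<bar> \<le> C * dist x y powr \<beta>)"

text \<open>
  A coordinate \<open>k\<close> plays the role of the last one. The pair \<open>(z', Re z\<^sub>k)\<close> is represented by the
  point obtained from \<open>z\<close> by replacing \<open>z\<^sub>k\<close> by its real part, so that the space of these pairs is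
  isometric to the real hyperplane \<open>Im z\<^sub>k = 0\<close>.
\<close>

definition drop_Im :: "'n \<Rightarrow> complex^'n \<Rightarrow> complex^'n" where
  "drop_Im k z = (\<chi> i. if i = k then complex_of_real (Re (z $ k)) else z $ i)"

definition Hoelder_boundary :: "(complex^'n) set \<Rightarrow> bool" where
  "Hoelder_boundary \<Omega> \<longleftrightarrow>
     (\<forall>p\<in>frontier \<Omega>. \<exists>U V \<Phi> r k g \<beta>.
        p \<in> U \<and> biholomorphic_map U V \<Phi> \<and> \<Phi> p = 0 \<and> r > 0 \<and> ball 0 r \<subseteq> V \<and>
        0 < \<beta> \<and> \<beta> < 1 \<and> Hoelder_on \<beta> {\<zeta>. Im (\<zeta> $ k) = 0 \<and> norm \<zeta> < r} g \<and> g 0 = 0 \<and>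
        \<Phi> ` (\<Omega> \<inter> U) \<inter> ball 0 r = {z \<in> ball 0 r. Im (z $ k) < g (drop_Im k z)})"

text \<open>
  Plurisubharmonicity of a finite-valued function on an open set: upper semicontinuity, and the
  sub-mean value inequality on the boundary circle of every closed disc
  \<open>{a + \<zeta> b | \<bar>\<zeta>\<bar> \<le> 1}\<close> in \<open>S\<close>. Since the value \<open>-\<infinity>\<close> is excluded, the circle means of a
  plurisubharmonic function are finite, whence the integrability requirement.
\<close>

definition plurisubharmonic_on :: "(complex^'n) set \<Rightarrow> (complex^'n \<Rightarrow> real) \<Rightarrow> bool" where
  "plurisubharmonic_on S u \<longleftrightarrow>
     (\<forall>c. openin (top_of_set S) {x \<in> S. u x < c}) \<and>
     (\<forall>a b. (\<lambda>\<zeta>. a + \<zeta> *s b) ` cball 0 1 \<subseteq> S \<longrightarrow>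
        set_integrable lborel {0..2 * pi} (\<lambda>t. u (a + cis t *s b)) \<and>
        u a \<le> (1 / (2 * pi)) * (LINT t:{0..2 * pi}|lborel. u (a + cis t *s b)))"

definition pseudoconvex :: "(complex^'n) set \<Rightarrow> bool" where
  "pseudoconvex \<Omega> \<longleftrightarrow>
     (\<exists>u. continuous_on \<Omega> u \<and> plurisubharmonic_on \<Omega> u \<and> (\<forall>c. compact {z \<in> \<Omega>. u z \<le> c}))"

end

theory Submission
  imports Defs "HOL-Complex_Analysis.Cauchy_Integral_Formula"
begin

text \<open>
  Write \<open>\<phi> = - log d\<close>. Pseudoconvexity makes \<open>\<phi>\<close> plurisubharmonic (Oka). In a boundary
  chart, the composition of \<open>\<phi>\<close> with the translation by \<open>exp (- L)\<close> into the domain is at most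
  \<open>L / \<beta>\<close> up to constants, by the Hoelder condition, at least about \<open>L\<close> near the boundary, and
  close to \<open>\<phi>\<close> where \<open>\<phi>\<close> is much smaller than \<open>L\<close>. After normalisation it is a
  plurisubharmonic function between \<open>- 1\<close> and \<open>0\<close> that equals \<open>- 1\<close> for \<open>\<phi> \<le> 2 L\<close> and is at
  least \<open>- \<theta>\<close>, \<open>\<theta> < 1\<close>, for \<open>\<phi> \<ge> A L\<close>. Iterating over finitely many scales makes \<open>\<theta>\<close>
  arbitrarily small, and averaging over scales makes the functions of different charts comparable
  up to a small error, so that they can be glued to functions defined near the whole boundary.
  These are finally iterated over all scales \<open>L = A\<^sup>k L\<^sub>0\<close> with weights that decay by a factor
  of at least \<open>1/2\<close> per step; the weights \<open>L powr (- \<tau>) / log L\<close> with \<open>A powr \<tau> = 4/3\<close> are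
  slow enough.
\<close>

section \<open>Circle means\<close>

text \<open>The Hoelder condition controls \<phi> only up to a factor: translation by exp (- L)
  takes boundary points to a depth somewhere between exp (- L / \<beta>) and exp (- L), up to
  constants. Hence comparisons lose a factor rather than a summand, all scales are geometric, and
  one chart yields only some \<theta> < 1, possibly close to 1. Translations in different charts are
  moreover unrelated: between 2 L and A L two barriers may differ by a fixed amount, however small
  \<theta> is, whereas a quadratic correction on balls of fixed radius absorbs only small
  differences. Averaging leaves a single summand in transition at each point. The exponent \<tau>
  reflects the final iteration: from scale L to A L the power of \<phi> may change by a factor below
  2, and the choice 4/3 leaves 3/2 for the growth of the logarithm.\<close>

definition circle_mean :: "(complex \<Rightarrow> real) \<Rightarrow> real" where
  "circle_mean h = integral {0..2 * pi} (\<lambda>t. h (cis t)) / (2 * pi)"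

lemma continuous_on_cis_comp:
  assumes "continuous_on (sphere 0 1) h"
  shows "continuous_on A (\<lambda>t. h (cis t))"
  by (rule continuous_on_compose2[OF assms]) (auto intro!: continuous_intros)

lemma circle_integrable:
  assumes "continuous_on (sphere 0 1) h"
  shows "(\<lambda>t. h (cis t) :: real) integrable_on {0..2 * pi}"
  by (intro integrable_continuous_real continuous_on_cis_comp assms)

lemma circle_mean_mono:
  assumes "continuous_on (sphere 0 1) f" "continuous_on (sphere 0 1) g"
    and "\<And>\<zeta>. cmod \<zeta> = 1 \<Longrightarrow> f \<zeta> \<le> g \<zeta>"
  shows "circle_mean f \<le> circle_mean g"
  unfolding circle_mean_def
  by (intro divide_right_mono integral_le circle_integrable assms) auto

lemma circle_mean_const: "circle_mean (\<lambda>_. c) = c"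
  by (simp add: circle_mean_def)

lemma circle_mean_add:
  assumes "continuous_on (sphere 0 1) f" "continuous_on (sphere 0 1) g"
  shows "circle_mean (\<lambda>\<zeta>. f \<zeta> + g \<zeta>) = circle_mean f + circle_mean g"
  unfolding circle_mean_def
  by (subst integral_add) (auto intro: circle_integrable assms simp: add_divide_distrib)

lemma circle_mean_cmult: "circle_mean (\<lambda>\<zeta>. c * f \<zeta>) = c * circle_mean f"
  by (simp add: circle_mean_def)

lemma circle_mean_cong:
  assumes "\<And>\<zeta>. cmod \<zeta> = 1 \<Longrightarrow> f \<zeta> = g \<zeta>"
  shows "circle_mean f = circle_mean g"
  unfolding circle_mean_def by (simp add: assms)

text \<open>Cauchy's formula at the centre. Means of other functions are estimated by comparison
  with such real parts.\<close>

lemma circle_mean_Re_holomorphic: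
  assumes "continuous_on (cball 0 1) f" "f holomorphic_on ball 0 1"
  shows "circle_mean (\<lambda>\<zeta>. Re (f \<zeta>)) = Re (f 0)"
proof -
  have "((\<lambda>u. f u / (u - 0)) has_contour_integral (2 * of_real pi * \<i> * f 0)) (circlepath 0 1)"
    by (rule Cauchy_integral_circlepath[OF assms]) simp
  then have "((\<lambda>t. f (cis t) / cis t * \<i> * cis t) has_integral (2 * of_real pi * \<i> * f 0)) {0..2 * pi}"
    unfolding circlepath_def by (subst (asm) has_contour_integral_part_circlepath_iff) auto
  then have "((\<lambda>t. \<i> * f (cis t)) has_integral (\<i> * (2 * of_real pi * f 0))) {0..2 * pi}"
    by (simp add: mult_ac)
  from has_integral_mult_right[OF this, of "- \<i>"]
  have "((\<lambda>t. f (cis t)) has_integral (2 * of_real pi * f 0)) {0..2 * pi}"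
    by (simp flip: mult.assoc)
  from has_integral_linear[OF this bounded_linear_Re]
  have "((\<lambda>t. Re (f (cis t))) has_integral (2 * pi * Re (f 0))) {0..2 * pi}"
    by (simp add: o_def)
  then have "integral {0..2 * pi} (\<lambda>t. Re (f (cis t))) = 2 * pi * Re (f 0)"
    by (rule integral_unique)
  then show ?thesis
    by (simp add: circle_mean_def)
qed

lemma circle_mean_set_integral:
  assumes "continuous_on (sphere 0 1) h"
  shows "set_integrable lborel {0..2 * pi} (\<lambda>t. h (cis t))"
    and "(1 / (2 * pi)) * (LINT t:{0..2 * pi}|lborel. h (cis t)) = circle_mean h"
proof -
  show *: "set_integrable lborel {0..2 * pi} (\<lambda>t. h (cis t))"
    by (rule borel_integrable_atLeastAtMost') (rule continuous_on_cis_comp[OF assms])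
  show "(1 / (2 * pi)) * (LINT t:{0..2 * pi}|lborel. h (cis t)) = circle_mean h"
    using set_borel_integral_eq_integral(2)[OF *] by (simp add: circle_mean_def)
qed

text \<open>
  Real trigonometric polynomials, as functions on the plane of which only the values on the unit
  circle matter.
\<close>

inductive trig_poly :: "(complex \<Rightarrow> real) \<Rightarrow> bool" where
  monom: "(\<And>\<zeta>. cmod \<zeta> = 1 \<Longrightarrow> g \<zeta> = Re (c * \<zeta> ^ k)) \<Longrightarrow> trig_poly g"
| add: "trig_poly f \<Longrightarrow> trig_poly h \<Longrightarrow> (\<And>\<zeta>. cmod \<zeta> = 1 \<Longrightarrow> g \<zeta> = f \<zeta> + h \<zeta>) \<Longrightarrow> trig_poly g"

text \<open>Uses Re a * Re b = Re (a * b) / 2 + Re (a * cnj b) / 2. On the unit circle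
  \<open>cnj \<zeta>\<close> is the inverse of \<open>\<zeta>\<close>, so the second term is again a
  monomial; the factors are exchanged according to \<open>k \<le> l\<close> to keep its exponent
  \<open>m\<close> a natural number.\<close>

lemma trig_poly_mult_monom:
  assumes "trig_poly f" "\<And>\<zeta>. cmod \<zeta> = 1 \<Longrightarrow> g \<zeta> = f \<zeta> * Re (c * \<zeta> ^ k)"
  shows "trig_poly g"
  using assms
proof (induction arbitrary: g rule: trig_poly.induct)
  case (monom f d l)
  define m where "m = (if k \<le> l then l - k else k - l)"
  define e where "e = (if k \<le> l then d * cnj c else c * cnj d)"
  have "g \<zeta> = Re ((c * d / 2) * \<zeta> ^ (k + l)) + Re (e / 2 * \<zeta> ^ m)" if "cmod \<zeta> = 1" for \<zeta>
  proof -
    have u: "\<zeta> * cnj \<zeta> = 1"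
      using that by (simp add: complex_norm_square[symmetric])
    have red: "\<zeta> ^ (a + b) * cnj (\<zeta> ^ b) = \<zeta> ^ a" for a b
    proof -
      have "\<zeta> ^ (a + b) * cnj (\<zeta> ^ b) = \<zeta> ^ a * (\<zeta> * cnj \<zeta>) ^ b"
        by (simp only: power_add power_mult_distrib complex_cnj_power mult_ac)
      with u show ?thesis by simp
    qed
    have two: "Re A * Re B = Re (B * A / 2) + Re (A * cnj B / 2)" for A B :: complex
      by (simp add: field_simps)
    have two': "Re A * Re B = Re (B * A / 2) + Re (B * cnj A / 2)" for A B :: complex
      by (simp add: field_simps)
    show ?thesis
    proof (cases "k \<le> l")
      case True
      then have "\<zeta> ^ l * cnj (\<zeta> ^ k) = \<zeta> ^ (l - k)"
        using red[of "l - k" k] by simp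
      then have "(d * \<zeta> ^ l) * cnj (c * \<zeta> ^ k) / 2 = e / 2 * \<zeta> ^ m"
        using True by (simp add: e_def m_def mult_ac)
      moreover have "(c * \<zeta> ^ k) * (d * \<zeta> ^ l) / 2 = (c * d / 2) * \<zeta> ^ (k + l)"
        by (simp add: power_add)
      ultimately show ?thesis
        by (simp only: monom(1,2)[OF that] two)
    next
      case False
      then have "\<zeta> ^ k * cnj (\<zeta> ^ l) = \<zeta> ^ (k - l)"
        using red[of "k - l" l] by simp
      then have "(c * \<zeta> ^ k) * cnj (d * \<zeta> ^ l) / 2 = e / 2 * \<zeta> ^ m"
        using False by (simp add: e_def m_def mult_ac)
      moreover have "(c * \<zeta> ^ k) * (d * \<zeta> ^ l) / 2 = (c * d / 2) * \<zeta> ^ (k + l)"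
        by (simp add: power_add)
      ultimately show ?thesis
        by (simp only: monom(1,2)[OF that] two')
    qed
  qed
  note eq = this
  show ?case
  proof (rule trig_poly.add)
    show "trig_poly (\<lambda>\<zeta>. Re ((c * d / 2) * \<zeta> ^ (k + l)))" "trig_poly (\<lambda>\<zeta>. Re (e / 2 * \<zeta> ^ m))"
      by (rule trig_poly.monom, rule refl)+
  qed (rule eq)
next
  case (add f1 f2 f)
  show ?case
  proof (rule trig_poly.add)
    show "trig_poly (\<lambda>\<zeta>. f1 \<zeta> * Re (c * \<zeta> ^ k))" "trig_poly (\<lambda>\<zeta>. f2 \<zeta> * Re (c * \<zeta> ^ k))"
      by (rule add.IH; simp)+
  qed (simp add: add ring_distribs)
qed

lemma trig_poly_mult:
  assumes "trig_poly h" "trig_poly f" "\<And>\<zeta>. cmod \<zeta> = 1 \<Longrightarrow> g \<zeta> = f \<zeta> * h \<zeta>"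
  shows "trig_poly g"
  using assms
proof (induction arbitrary: g rule: trig_poly.induct)
  case (monom h c k)
  then show ?case by (intro trig_poly_mult_monom[of f g c k]) auto
next
  case (add h1 h2 h)
  show ?case
  proof (rule trig_poly.add)
    show "trig_poly (\<lambda>\<zeta>. f \<zeta> * h1 \<zeta>)" "trig_poly (\<lambda>\<zeta>. f \<zeta> * h2 \<zeta>)"
      by (rule add.IH; simp add: add)+
  qed (simp add: add ring_distribs)
qed

lemma trig_poly_holomorphic:
  assumes "trig_poly g"
  obtains p where "p holomorphic_on UNIV" "\<And>\<zeta>. cmod \<zeta> = 1 \<Longrightarrow> g \<zeta> = Re (p \<zeta>)"
proof -
  have "\<exists>p. p holomorphic_on UNIV \<and> (\<forall>\<zeta>. cmod \<zeta> = 1 \<longrightarrow> g \<zeta> = Re (p \<zeta>))"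
    using assms
  proof induction
    case (monom g c k)
    have "(\<lambda>\<zeta>. c * \<zeta> ^ k) holomorphic_on UNIV"
      by (intro holomorphic_intros)
    with monom show ?case by blast
  next
    case (add f h g)
    then obtain p q where "p holomorphic_on UNIV" "q holomorphic_on UNIV"
      "\<forall>\<zeta>. cmod \<zeta> = 1 \<longrightarrow> f \<zeta> = Re (p \<zeta>)" "\<forall>\<zeta>. cmod \<zeta> = 1 \<longrightarrow> h \<zeta> = Re (q \<zeta>)"
      by blast
    with add.hyps show ?case
      by (intro exI[of _ "\<lambda>\<zeta>. p \<zeta> + q \<zeta>"]) (auto intro: holomorphic_intros)
  qed
  with that show ?thesis by blast
qed

lemma trig_poly_continuous: "trig_poly g \<Longrightarrow> continuous_on (sphere 0 1) g"
proof (erule trig_poly_holomorphic)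
  fix p assume p: "p holomorphic_on UNIV" "\<And>\<zeta>. cmod \<zeta> = 1 \<Longrightarrow> g \<zeta> = Re (p \<zeta>)"
  have "continuous_on (sphere 0 1) (\<lambda>\<zeta>. Re (p \<zeta>))"
    by (intro continuous_intros continuous_on_subset[OF holomorphic_on_imp_continuous_on[OF p(1)]]) auto
  then show "continuous_on (sphere 0 1) g"
    by (rule continuous_on_eq) (simp add: p(2))
qed

text \<open>Takes the place of the Dirichlet problem: Re p is harmonic, is close to \<open>h\<close>
  on the circle, and its mean is its value at the centre. Stone-Weierstrass applies because Re and
  Im separate the points of the circle.\<close>

lemma circle_approx_holomorphic:
  fixes h :: "complex \<Rightarrow> real"
  assumes "continuous_on (sphere 0 1) h" "e > 0"
  obtains p where "p holomorphic_on UNIV" "\<And>\<zeta>. cmod \<zeta> = 1 \<Longrightarrow> \<bar>h \<zeta> - Re (p \<zeta>)\<bar> < e"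
proof -
  have "\<exists>g. trig_poly g \<and> (\<forall>x\<in>sphere 0 1. \<bar>h x - g x\<bar> < e)"
  proof (rule Stone_Weierstrass_HOL)
    show "trig_poly (\<lambda>x. c)" for c
      by (rule trig_poly.monom[of _ "of_real c" 0]) simp
    show "trig_poly f \<and> trig_poly g \<Longrightarrow> trig_poly (\<lambda>x. f x + g x)" for f g
      by (auto intro: trig_poly.add)
    show "trig_poly f \<and> trig_poly g \<Longrightarrow> trig_poly (\<lambda>x. f x * g x)" for f g
      by (auto intro: trig_poly_mult)
    show "\<exists>f. trig_poly f \<and> f x \<noteq> f y" if "x \<in> sphere 0 1 \<and> y \<in> sphere 0 1 \<and> x \<noteq> y" for x y
    proof -
      have "trig_poly Re" "trig_poly Im"
        by (rule trig_poly.monom[of _ 1 1] trig_poly.monom[of _ "- \<i>" 1]; simp)+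
      with that show ?thesis by (metis complex_eqI)
    qed
  qed (auto intro: trig_poly_continuous assms)
  then obtain g where g: "trig_poly g" "\<And>\<zeta>. cmod \<zeta> = 1 \<Longrightarrow> \<bar>h \<zeta> - g \<zeta>\<bar> < e"
    by auto
  obtain p where p: "p holomorphic_on UNIV" "\<And>\<zeta>. cmod \<zeta> = 1 \<Longrightarrow> g \<zeta> = Re (p \<zeta>)"
    using trig_poly_holomorphic[OF g(1)] by blast
  show thesis
    by (rule that[OF p(1)]) (use g(2) p(2) in fastforce)
qed

section \<open>Plurisubharmonic functions and holomorphic discs\<close>

lemma norm_vector_smult: "norm (c *s (x :: complex^'n)) = cmod c * norm x"
  by (simp add: norm_vec_def L2_set_right_distrib norm_mult)

lemma continuous_on_vector_smult [continuous_intros]: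
  fixes g :: "'a::topological_space \<Rightarrow> complex" and h :: "'a \<Rightarrow> complex^'n"
  assumes "continuous_on A g" "continuous_on A h"
  shows "continuous_on A (\<lambda>x. g x *s h x)"
  unfolding vector_scalar_mult_def
  by (intro continuous_intros assms)

text \<open>The real inner product is the real part of the Hermitian one. Hence real affine
  functions, and the linear terms in the expansion of a squared norm, are harmonic along complex
  lines.\<close>

lemma inner_vector_smult:
  fixes a v :: "complex^'n"
  shows "(c *s v) \<bullet> a = Re (c * (\<Sum>i\<in>UNIV. v $ i * cnj (a $ i)))"
  by (simp add: inner_vec_def inner_complex_def sum_distrib_left algebra_simps sum.distrib
      flip: sum_subtractf)

lemma inner_Re_sum:
  fixes a v :: "complex^'n"
  shows "v \<bullet> a = Re (\<Sum>i\<in>UNIV. v $ i * cnj (a $ i))"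
  using inner_vector_smult[of 1 v a] by simp

text \<open>Holomorphy is required coordinatewise so that one-variable theory applies directly;
  \<open>hol_curve_has_derivative\<close> recovers the complex linear derivative of the
  vector-valued map.\<close>

definition hol_curve :: "complex set \<Rightarrow> (complex \<Rightarrow> complex^'n) \<Rightarrow> bool" where
  "hol_curve T f \<longleftrightarrow> (\<forall>i. (\<lambda>\<zeta>. f \<zeta> $ i) holomorphic_on T)"

lemma hol_curve_continuous_on:
  assumes "hol_curve T f" "A \<subseteq> T"
  shows "continuous_on A f"
proof -
  have "continuous_on A (\<lambda>\<zeta>. \<chi> i. f \<zeta> $ i)"
    using assms unfolding hol_curve_def
    by (intro continuous_on_vec_lambda holomorphic_on_imp_continuous_on) (auto intro: holomorphic_on_subset)
  then show ?thesis by simp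
qed

lemma hol_curve_has_derivative:
  fixes f :: "complex \<Rightarrow> complex^'n"
  assumes "hol_curve T f" "open T" "\<zeta> \<in> T"
  obtains v where "(f has_derivative (\<lambda>h. h *s v)) (at \<zeta>)"
proof -
  define v where "v = (\<chi> i. deriv (\<lambda>\<zeta>. f \<zeta> $ i) \<zeta>)"
  have "(f has_derivative (\<lambda>h. h *s v)) (at \<zeta> within UNIV)"
  proof (subst has_derivative_componentwise_within, rule ballI)
    fix e :: "complex^'n" assume "e \<in> Basis"
    then obtain i b where e: "e = axis i b"
      by (auto simp: Basis_vec_def)
    have "((\<lambda>\<zeta>. f \<zeta> $ i) has_field_derivative v $ i) (at \<zeta>)"
      using assms unfolding hol_curve_def v_def by (auto intro: holomorphic_derivI)
    then have "((\<lambda>\<zeta>. f \<zeta> $ i) has_derivative (\<lambda>h. h * v $ i)) (at \<zeta>)"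
      unfolding has_field_derivative_def mult.commute[of "v $ i"] .
    from has_derivative_inner_left[OF this]
    have "((\<lambda>\<zeta>. f \<zeta> $ i \<bullet> b) has_derivative (\<lambda>h. (h * v $ i) \<bullet> b)) (at \<zeta>)" .
    then show "((\<lambda>x. f x \<bullet> e) has_derivative (\<lambda>x. (x *s v) \<bullet> e)) (at \<zeta>)"
      by (simp add: e inner_axis)
  qed
  then show ?thesis by (rule that)
qed

text \<open>The working notion: continuous, and tested only on affine discs whose admissible size
  may depend on the centre. This makes it local, hence suited to gluing; arbitrary holomorphic discs
  are reached by \<open>psh_disc_mean\<close>.\<close>

definition psh :: "(complex^'n) set \<Rightarrow> (complex^'n \<Rightarrow> real) \<Rightarrow> bool" where
  "psh S u \<longleftrightarrow> continuous_on S u \<and>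
     (\<forall>z\<in>S. \<exists>\<rho>>0. ball z \<rho> \<subseteq> S \<and>
        (\<forall>b. norm b < \<rho> \<longrightarrow> u z \<le> circle_mean (\<lambda>\<zeta>. u (z + \<zeta> *s b))))"

lemma psh_continuous: "psh S u \<Longrightarrow> continuous_on S u"
  by (simp add: psh_def)

lemma psh_open: "psh S u \<Longrightarrow> open S"
  unfolding open_contains_ball psh_def by blast

lemma pshE:
  assumes "psh S u" "z \<in> S"
  obtains \<rho> where "\<rho> > 0" "ball z \<rho> \<subseteq> S"
    "\<And>b. norm b < \<rho> \<Longrightarrow> u z \<le> circle_mean (\<lambda>\<zeta>. u (z + \<zeta> *s b))"
  using assms unfolding psh_def by blast

lemma continuous_on_affine_circle:
  fixes u :: "complex^'n \<Rightarrow> real"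
  assumes "continuous_on S u" "ball z \<rho> \<subseteq> S" "norm b < \<rho>"
  shows "continuous_on (sphere 0 1) (\<lambda>\<zeta>. u (z + \<zeta> *s b))"
  by (rule continuous_on_compose2[OF assms(1)])
    (use assms(2,3) in \<open>auto intro!: continuous_intros simp: dist_norm norm_vector_smult subset_iff\<close>)

text \<open>
  Doubling of variables: since \<open>u\<close> is only continuous, an interior maximum of
  \<open>u \<circ> f + Re p + e |\<zeta>|\<^sup>2\<close> is replaced by a maximum of
  \<open>u z + Re (p \<zeta>) + e |\<zeta>|\<^sup>2 - N |z - f \<zeta>|\<^sup>2\<close> over pairs, where the sub-mean value property
  of \<open>u\<close> can be applied on the circle in the direction of the tangent of \<open>f\<close>.
\<close>

lemma psh_disc_maximum_principle:
  fixes f :: "complex \<Rightarrow> complex^'n"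
  assumes u: "psh S u" and T: "open T" "cball 0 1 \<subseteq> T"
    and f: "hol_curve T f" "f ` cball 0 1 \<subseteq> S" and p: "p holomorphic_on T"
    and bd: "\<And>\<zeta>. cmod \<zeta> = 1 \<Longrightarrow> u (f \<zeta>) + Re (p \<zeta>) \<le> m"
    and \<zeta>0: "cmod \<zeta>0 \<le> 1"
  shows "u (f \<zeta>0) + Re (p \<zeta>0) \<le> m"
proof (rule ccontr)
  assume neg: "\<not> ?thesis"
  \<comment> \<open>Of the excess \<open>3 * e\<close>, one \<open>e\<close> pays for the strictly
    subharmonic term \<open>e * (cmod \<zeta>)\<^sup>2\<close> and one for replacing
    \<open>u z1\<close> by \<open>u (f \<zeta>1)\<close>; the third excludes a maximum over the unit
    circle.\<close>
  define e where "e = (u (f \<zeta>0) + Re (p \<zeta>0) - m) / 3"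
  have e: "e > 0" and e3: "u (f \<zeta>0) + Re (p \<zeta>0) = m + 3 * e"
    using neg by (simp_all add: e_def field_simps)
  have contu: "continuous_on S u" and opS: "open S"
    using u psh_continuous psh_open by auto
  define C where "C = f ` cball 0 1"
  have contf: "continuous_on (cball 0 1) f"
    by (rule hol_curve_continuous_on[OF f(1) T(2)])
  have C: "compact C" "C \<noteq> {}" "C \<subseteq> S"
    using f(2) compact_continuous_image[OF contf] by (auto simp: C_def)
  obtain \<sigma> where \<sigma>: "\<sigma> > 0" "{x. infdist x C \<le> \<sigma>} \<subseteq> S"
    using compact_in_open_separated[OF C(2,1) opS C(3)] by blast
  define K where "K = {x. infdist x C \<le> \<sigma>}"
  have K: "compact K" "K \<subseteq> S" "C \<subseteq> K"
    using compact_infdist_le[OF C(2,1) \<sigma>(1)] \<sigma> by (auto simp: K_def)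
  have contuK: "continuous_on K u"
    using continuous_on_subset[OF contu K(2)] .
  then have "uniformly_continuous_on K u"
    using K(1) compact_uniformly_continuous by blast
  then obtain \<delta>' where \<delta>': "\<delta>' > 0" "\<And>x y. x \<in> K \<Longrightarrow> y \<in> K \<Longrightarrow> dist y x < \<delta>' \<Longrightarrow> dist (u y) (u x) < e"
    unfolding uniformly_continuous_on_def using e by meson
  have "bounded (u ` K)"
    using compact_continuous_image[OF contuK K(1)] compact_imp_bounded by blast
  then obtain B0 where B0: "\<And>x. x \<in> K \<Longrightarrow> \<bar>u x\<bar> \<le> B0"
    unfolding bounded_iff by auto
  have contp: "continuous_on (cball 0 1) p"
    using p T(2) holomorphic_on_imp_continuous_on holomorphic_on_subset by blast
  then have "bounded (p ` cball 0 1)"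
    using compact_continuous_image compact_imp_bounded compact_cball by blast
  then obtain B1 where "\<forall>x\<in>cball 0 1. cmod (p x) \<le> B1"
    unfolding bounded_iff by blast
  then have B1': "cmod (p x) \<le> B1" if "cmod x \<le> 1" for x
    using that by simp
  have B1: "\<bar>Re (p x)\<bar> \<le> B1" if "cmod x \<le> 1" for x
    using B1'[OF that] abs_Re_le_cmod[of "p x"] by linarith
  define \<mu> where "\<mu> = min \<sigma> \<delta>'"
  have \<mu>: "\<mu> > 0" "\<mu> \<le> \<sigma>" "\<mu> \<le> \<delta>'"
    using \<sigma>(1) \<delta>'(1) by (auto simp: \<mu>_def)
  define D where "D = 2 * B0 + 2 * B1 + e"
  have fz0: "f \<zeta>0 \<in> K"
    using \<zeta>0 K(3) by (auto simp: C_def)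
  have D: "D > 0"
    using B0[OF fz0] B1[OF \<zeta>0] e by (simp add: D_def)
  \<comment> \<open>\<open>D\<close> bounds what the other terms of \<open>J\<close> can gain over
    the value at \<open>(\<zeta>0, f \<zeta>0)\<close>. With \<open>N * \<mu>\<^sup>2 > D\<close>
    the penalty therefore forces \<open>norm (z1 - f \<zeta>1) < \<mu>\<close>, which keeps
    \<open>z1\<close> away from the boundary of \<open>K\<close> and \<open>u z1\<close> within
    \<open>e\<close> of \<open>u (f \<zeta>1)\<close>.\<close>
  define N where "N = D / \<mu>\<^sup>2 + 1"
  have N: "N > 0"
    using D \<mu>(1) by (simp add: N_def add_pos_pos)
  define J where "J = (\<lambda>(\<zeta>, z). u z + Re (p \<zeta>) + e * (cmod \<zeta>)\<^sup>2 - N * (norm (z - f \<zeta>))\<^sup>2)"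
  have contJ: "continuous_on (cball 0 1 \<times> K) J"
    unfolding J_def case_prod_unfold
    by (intro continuous_intros continuous_on_compose2[OF contuK] continuous_on_compose2[OF contf]
        continuous_on_compose2[OF contp]) auto
  have "compact (cball (0::complex) 1 \<times> K)" "cball (0::complex) 1 \<times> K \<noteq> {}"
    using K(1) fz0 by (auto intro!: compact_Times)
  from continuous_attains_sup[OF this contJ]
  obtain \<zeta>1 z1 where z1: "cmod \<zeta>1 \<le> 1" "z1 \<in> K"
    and max: "\<And>\<zeta> z. cmod \<zeta> \<le> 1 \<Longrightarrow> z \<in> K \<Longrightarrow> J (\<zeta>, z) \<le> J (\<zeta>1, z1)"
    by auto
  define a where "a = z1 - f \<zeta>1"
  have J0: "J (\<zeta>0, f \<zeta>0) \<ge> m + 3 * e"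
    using e e3 by (simp add: J_def)
  have J1: "J (\<zeta>1, z1) \<ge> J (\<zeta>0, f \<zeta>0)"
    using max \<zeta>0 fz0 by blast
  have sq1: "(cmod \<zeta>1)\<^sup>2 \<le> 1"
    using z1(1) by (simp add: power_le_one)
  have esq1: "e * (cmod \<zeta>1)\<^sup>2 \<le> e"
    using mult_left_mono[OF sq1, of e] e by simp
  have "N * (norm a)\<^sup>2 \<le> u z1 + Re (p \<zeta>1) + e * (cmod \<zeta>1)\<^sup>2 - J (\<zeta>0, f \<zeta>0)"
    using J1 by (simp add: J_def a_def)
  also have "J (\<zeta>0, f \<zeta>0) \<ge> u (f \<zeta>0) + Re (p \<zeta>0)"
    using e by (simp add: J_def)
  then have "u z1 + Re (p \<zeta>1) + e * (cmod \<zeta>1)\<^sup>2 - J (\<zeta>0, f \<zeta>0) \<le> D"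
    using B0[OF fz0] B0[OF z1(2)] B1[OF \<zeta>0] B1[OF z1(1)] esq1 by (simp add: D_def)
  finally have "N * (norm a)\<^sup>2 \<le> D" .
  moreover have "D < N * \<mu>\<^sup>2"
    using \<mu>(1) by (simp add: N_def field_simps)
  ultimately have "N * (norm a)\<^sup>2 < N * \<mu>\<^sup>2"
    by linarith
  then have a\<mu>: "norm a < \<mu>"
    using N \<mu>(1) by (simp add: power2_less_imp_less)
  have fz1: "f \<zeta>1 \<in> C"
    using z1(1) by (auto simp: C_def)
  have uclose: "u z1 < u (f \<zeta>1) + e"
    using \<delta>'(2)[of "f \<zeta>1" z1] fz1 K(3) z1(2) a\<mu> \<mu>(3) by (auto simp: a_def dist_norm)
  have \<zeta>1: "cmod \<zeta>1 < 1"
  proof (rule ccontr)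
    assume "\<not> cmod \<zeta>1 < 1"
    then have *: "cmod \<zeta>1 = 1"
      using z1(1) by simp
    have "J (\<zeta>1, z1) \<le> u z1 + Re (p \<zeta>1) + e"
      using * N by (simp add: J_def)
    also have "\<dots> < m + 2 * e"
      using bd[OF *] uclose by linarith
    finally show False
      using J0 J1 e by linarith
  qed
  have \<zeta>1T: "\<zeta>1 \<in> T"
    using z1(1) T(2) by auto
  obtain v where v: "(f has_derivative (\<lambda>h. h *s v)) (at \<zeta>1)"
    using hol_curve_has_derivative[OF f(1) T(1) \<zeta>1T] by blast
  \<comment> \<open>With \<open>N * \<kappa>\<^sup>2 = e / 2\<close> the squared linearisation error
    of \<open>f\<close> at distance \<open>h\<close> costs at most half of the gain
    \<open>e * h\<^sup>2\<close>.\<close>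
  define \<kappa> where "\<kappa> = sqrt (e / (2 * N))"
  have \<kappa>: "\<kappa> > 0" "\<kappa>\<^sup>2 = e / (2 * N)"
    using e N by (auto simp: \<kappa>_def)
  obtain \<delta> where \<delta>: "\<delta> > 0"
    "\<And>y. cmod (y - \<zeta>1) < \<delta> \<Longrightarrow> norm (f y - f \<zeta>1 - (y - \<zeta>1) *s v) \<le> \<kappa> * cmod (y - \<zeta>1)"
    using v \<kappa>(1) unfolding has_derivative_at_alt by blast
  have "z1 \<in> S"
    using z1(2) K(2) by auto
  then obtain \<rho> where \<rho>: "\<rho> > 0" "ball z1 \<rho> \<subseteq> S"
    "\<And>b. norm b < \<rho> \<Longrightarrow> u z1 \<le> circle_mean (\<lambda>\<zeta>. u (z1 + \<zeta> *s b))"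
    using pshE[OF u] by metis
  define M where "M = min (min \<delta> (1 - cmod \<zeta>1)) (min (\<rho> / (norm v + 1)) ((\<sigma> - norm a) / (norm v + 1)))"
  define h where "h = M / 2"
  have "M > 0"
    using \<delta>(1) \<zeta>1 \<rho>(1) a\<mu> \<mu>(2) by (auto simp: M_def add_nonneg_pos)
  then have h: "h > 0" "h < M"
    by (auto simp: h_def)
  have h1: "h < \<delta>" "h < 1 - cmod \<zeta>1"
    using h by (auto simp: M_def)
  have "h * (norm v + 1) < \<rho>" "h * (norm v + 1) < \<sigma> - norm a"
    using h(2) by (auto simp: M_def pos_less_divide_eq add_nonneg_pos)
  then have h2: "h * norm v < \<rho>" "h * norm v < \<sigma> - norm a"
    using h(1) by (auto simp: distrib_left)
  \<comment> \<open>\<open>Re (H w)\<close> collects the harmonic terms of \<open>J\<close> along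
    the circle. It contains \<open>f\<close> itself, not only its tangent: the inner product of the
    error \<open>c\<close> with the fixed vector \<open>a\<close> could outweigh
    \<open>e * h\<^sup>2\<close>, but it is the real part of a holomorphic function vanishing at 0
    and so has mean 0.\<close>
  define H where "H = (\<lambda>w. p (\<zeta>1 + of_real h * w) + of_real (2 * e) * (cnj \<zeta>1 * (of_real h * w))
     - of_real (2 * N) * (\<Sum>i\<in>UNIV. ((of_real h * w) * v $ i - f (\<zeta>1 + of_real h * w) $ i + f \<zeta>1 $ i) * cnj (a $ i)))"
  have inball: "cmod (\<zeta>1 + of_real h * w) \<le> 1" if "cmod w \<le> 1" for w
  proof -
    have "cmod (\<zeta>1 + of_real h * w) \<le> cmod \<zeta>1 + h * cmod w"
      using norm_triangle_ineq[of \<zeta>1 "of_real h * w"] h(1) by (simp add: norm_mult)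
    also have "h * cmod w \<le> h * 1"
      using h(1) that by (intro mult_left_mono) auto
    finally show ?thesis using h1 by simp
  qed
  have inT: "(\<lambda>w. \<zeta>1 + of_real h * w) ` cball 0 1 \<subseteq> T"
    using inball T(2) by auto
  have holH: "H holomorphic_on (cball 0 1)"
    unfolding H_def using f(1)[unfolded hol_curve_def, rule_format] p inT
    by (intro holomorphic_intros holomorphic_on_compose_gen[unfolded o_def, of "\<lambda>w. \<zeta>1 + of_real h * w" _ p T]
        holomorphic_on_compose_gen[unfolded o_def, of "\<lambda>w. \<zeta>1 + of_real h * w" _ "\<lambda>w. f w $ i" T for i]) auto
  have H0: "H 0 = p \<zeta>1"
    by (simp add: H_def)
  have meanH: "circle_mean (\<lambda>w. Re (H w)) = Re (p \<zeta>1)"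
    using circle_mean_Re_holomorphic[of H] holH H0
    by (metis ball_subset_cball holomorphic_on_imp_continuous_on holomorphic_on_subset)
  have key: "u (z1 + w *s (h *s v)) + Re (H w) + e / 2 * h\<^sup>2 \<le> u z1 + Re (p \<zeta>1)" if w: "cmod w = 1" for w
  proof -
    define \<zeta> where "\<zeta> = \<zeta>1 + of_real h * w"
    define z where "z = z1 + w *s (h *s v)"
    have za: "z - z1 = (\<zeta> - \<zeta>1) *s v"
      by (simp add: z_def \<zeta>_def mult.commute)
    have nz: "norm (z - z1) = h * norm v"
      using h(1) w by (simp add: za norm_vector_smult \<zeta>_def norm_mult)
    have "infdist z C \<le> dist z (f \<zeta>1)"
      using fz1 by (rule infdist_le)
    also have "\<dots> = norm ((z - z1) + a)"
      by (simp add: a_def dist_norm)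
    also have "\<dots> \<le> h * norm v + norm a"
      using norm_triangle_ineq[of "z - z1" a] nz by simp
    finally have zK: "z \<in> K"
      using h2 by (simp add: K_def)
    have "J (\<zeta>, z) \<le> J (\<zeta>1, z1)"
      by (rule max) (use zK inball[of w] w in \<open>auto simp: \<zeta>_def\<close>)
    define c where "c = (\<zeta> - \<zeta>1) *s v - f \<zeta> + f \<zeta>1"
    have zf: "z - f \<zeta> = a + c"
      using za by (simp add: a_def c_def algebra_simps)
    have nc: "norm c \<le> \<kappa> * h"
    proof -
      have "cmod (\<zeta> - \<zeta>1) = h"
        using w h(1) by (simp add: \<zeta>_def norm_mult)
      then have "norm (f \<zeta> - f \<zeta>1 - (\<zeta> - \<zeta>1) *s v) \<le> \<kappa> * h"
        using \<delta>(2)[of \<zeta>] h1 by simp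
      moreover have "c = - (f \<zeta> - f \<zeta>1 - (\<zeta> - \<zeta>1) *s v)"
        by (simp add: c_def)
      ultimately show ?thesis by (simp only: norm_minus_cancel)
    qed
    then have "(norm c)\<^sup>2 \<le> (\<kappa> * h)\<^sup>2"
      by (intro power_mono) auto
    then have "N * (norm c)\<^sup>2 \<le> N * (\<kappa>\<^sup>2 * h\<^sup>2)"
      using N by (simp add: power_mult_distrib)
    also have "\<dots> = e / 2 * h\<^sup>2"
      using N by (simp add: \<kappa>)
    finally have nc2: "N * (norm c)\<^sup>2 \<le> e / 2 * h\<^sup>2" .
    have n1: "(norm (z - f \<zeta>))\<^sup>2 = (norm a)\<^sup>2 + 2 * (c \<bullet> a) + (norm c)\<^sup>2"
      unfolding zf power2_norm_eq_inner by (simp add: inner_commute algebra_simps)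
    have n2: "(cmod \<zeta>)\<^sup>2 = (cmod \<zeta>1)\<^sup>2 + 2 * Re (cnj \<zeta>1 * (of_real h * w)) + h\<^sup>2"
    proof -
      have "(cmod \<zeta>)\<^sup>2 = (cmod \<zeta>1)\<^sup>2 + 2 * (\<zeta>1 \<bullet> (of_real h * w)) + (cmod (of_real h * w))\<^sup>2"
        unfolding \<zeta>_def power2_norm_eq_inner by (simp add: inner_commute algebra_simps)
      moreover have "(cmod (of_real h * w))\<^sup>2 = h\<^sup>2"
        using w by (simp add: norm_mult)
      moreover have "\<zeta>1 \<bullet> (of_real h * w) = Re (cnj \<zeta>1 * (of_real h * w))"
        by (simp add: inner_complex_def)
      ultimately show ?thesis by simp
    qed
    have c: "c $ i = (of_real h * w) * v $ i - f \<zeta> $ i + f \<zeta>1 $ i" for i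
      by (simp add: c_def \<zeta>_def)
    have ReH: "Re (H w) = Re (p \<zeta>) + 2 * e * Re (cnj \<zeta>1 * (of_real h * w)) - 2 * N * (c \<bullet> a)"
    proof -
      have R: "Re (of_real r * y) = r * Re y" for r and y :: complex
        by simp
      have "H w = p \<zeta> + of_real (2 * e) * (cnj \<zeta>1 * (of_real h * w)) - of_real (2 * N) * (\<Sum>i\<in>UNIV. c $ i * cnj (a $ i))"
        unfolding H_def c by (simp add: \<zeta>_def mult.assoc)
      then show ?thesis
        unfolding inner_Re_sum[of c a] by (simp only: plus_complex.sel minus_complex.sel R)
    qed
    have "J (\<zeta>, z) = u z + (Re (H w) + 2 * N * (c \<bullet> a) - 2 * e * Re (cnj \<zeta>1 * (of_real h * w)))
        + e * ((cmod \<zeta>1)\<^sup>2 + 2 * Re (cnj \<zeta>1 * (of_real h * w)) + h\<^sup>2) - N * ((norm a)\<^sup>2 + 2 * (c \<bullet> a) + (norm c)\<^sup>2)"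
      unfolding J_def case_prod_conv n1 n2 ReH by simp
    also have "\<dots> = u z + Re (H w) + e * (cmod \<zeta>1)\<^sup>2 + e * h\<^sup>2 - N * (norm a)\<^sup>2 - N * (norm c)\<^sup>2"
      by (simp add: distrib_left mult.assoc mult.left_commute)
    finally have "J (\<zeta>, z) = u z + Re (H w) + e * (cmod \<zeta>1)\<^sup>2 + e * h\<^sup>2 - N * (norm a)\<^sup>2 - N * (norm c)\<^sup>2" .
    moreover have "J (\<zeta>1, z1) = u z1 + Re (p \<zeta>1) + e * (cmod \<zeta>1)\<^sup>2 - N * (norm a)\<^sup>2"
      by (simp add: J_def a_def)
    ultimately show ?thesis
      using \<open>J (\<zeta>, z) \<le> J (\<zeta>1, z1)\<close> nc2 unfolding z_def by simp
  qed
  have nb: "norm (h *s v) < \<rho>"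
    using h2 h(1) by (simp add: norm_vector_smult)
  have c1: "continuous_on (sphere 0 1) (\<lambda>w. u (z1 + w *s (h *s v)))"
    by (rule continuous_on_affine_circle[OF contu \<rho>(2) nb])
  have c2: "continuous_on (sphere 0 1) (\<lambda>w. Re (H w))"
    by (intro continuous_intros continuous_on_subset[OF holomorphic_on_imp_continuous_on[OF holH]]) auto
  have "circle_mean (\<lambda>w. u (z1 + w *s (h *s v)) + Re (H w) + e / 2 * h\<^sup>2) \<le> circle_mean (\<lambda>_. u z1 + Re (p \<zeta>1))"
    by (intro circle_mean_mono continuous_intros c1 c2 key)
  also have "circle_mean (\<lambda>w. u (z1 + w *s (h *s v)) + Re (H w) + e / 2 * h\<^sup>2)
      = circle_mean (\<lambda>w. u (z1 + w *s (h *s v))) + Re (p \<zeta>1) + e / 2 * h\<^sup>2"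
    unfolding circle_mean_add[OF continuous_on_add[OF c1 c2] continuous_on_const]
      circle_mean_add[OF c1 c2] meanH circle_mean_const ..
  finally have "e / 2 * h\<^sup>2 \<le> 0"
    using \<rho>(3)[OF nb] by (simp add: circle_mean_const)
  moreover have "e / 2 * h\<^sup>2 > 0"
    using e h(1) by simp
  ultimately show False by linarith
qed

text \<open>If Re p approximates \<open>u\<close> along the boundary of the disc, the maximum
  principle for \<open>u\<close> minus Re p bounds \<open>u (f 0)\<close> by Re (p 0) up to a small
  error, and Re (p 0) is the circle mean of Re p.\<close>

lemma psh_disc_mean:
  fixes f :: "complex \<Rightarrow> complex^'n"
  assumes u: "psh S u" and T: "open T" "cball 0 1 \<subseteq> T"
    and f: "hol_curve T f" "f ` cball 0 1 \<subseteq> S"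
  shows "u (f 0) \<le> circle_mean (\<lambda>\<zeta>. u (f \<zeta>))"
proof (rule field_le_epsilon)
  fix e :: real assume e: "e > 0"
  have cont: "continuous_on (sphere 0 1) (\<lambda>\<zeta>. u (f \<zeta>))"
    by (rule continuous_on_compose2[OF psh_continuous[OF u]])
      (use f T hol_curve_continuous_on[OF f(1), of "sphere 0 1"] in \<open>auto simp: subset_iff\<close>)
  obtain p where p: "p holomorphic_on UNIV" "\<And>\<zeta>. cmod \<zeta> = 1 \<Longrightarrow> \<bar>u (f \<zeta>) - Re (p \<zeta>)\<bar> < e / 2"
    using circle_approx_holomorphic[OF cont, of "e / 2"] e by auto
  have 1: "u (f 0) + Re (- p 0) \<le> e / 2"
  proof (rule psh_disc_maximum_principle[OF u T f])
    show "(\<lambda>\<zeta>. - p \<zeta>) holomorphic_on T"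
      using p(1) by (intro holomorphic_intros) (auto intro: holomorphic_on_subset)
    show "u (f \<zeta>) + Re (- p \<zeta>) \<le> e / 2" if "cmod \<zeta> = 1" for \<zeta>
      using p(2)[OF that] by (simp only: uminus_complex.sel abs_less_iff) linarith
  qed simp
  have 2: "Re (p 0) = circle_mean (\<lambda>\<zeta>. Re (p \<zeta>))"
    using p(1) by (intro circle_mean_Re_holomorphic[symmetric])
      (auto intro: holomorphic_on_subset continuous_on_subset dest: holomorphic_on_imp_continuous_on)
  have "circle_mean (\<lambda>\<zeta>. Re (p \<zeta>)) \<le> circle_mean (\<lambda>\<zeta>. u (f \<zeta>) + e / 2)"
  proof (rule circle_mean_mono)
    show "continuous_on (sphere 0 1) (\<lambda>\<zeta>. Re (p \<zeta>))"
      using p(1) by (intro continuous_intros) (auto intro: continuous_on_subset dest: holomorphic_on_imp_continuous_on)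
    show "Re (p \<zeta>) \<le> u (f \<zeta>) + e / 2" if "cmod \<zeta> = 1" for \<zeta>
      using p(2)[OF that] by linarith
  qed (intro continuous_intros cont)
  also have "\<dots> = circle_mean (\<lambda>\<zeta>. u (f \<zeta>)) + e / 2"
    by (simp add: circle_mean_add cont circle_mean_const)
  finally show "u (f 0) \<le> circle_mean (\<lambda>\<zeta>. u (f \<zeta>)) + e"
    using 1 2 by simp
qed

section \<open>Local character and closure properties\<close>

lemma psh_subset: "psh S u \<Longrightarrow> open N \<Longrightarrow> N \<subseteq> S \<Longrightarrow> psh N u"
  unfolding psh_def
proof (intro conjI ballI)
  fix z assume u: "continuous_on S u \<and> (\<forall>z\<in>S. \<exists>\<rho>>0. ball z \<rho> \<subseteq> S \<and>
        (\<forall>b. norm b < \<rho> \<longrightarrow> u z \<le> circle_mean (\<lambda>\<zeta>. u (z + \<zeta> *s b))))" and N: "open N" "N \<subseteq> S" "z \<in> N"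
  then obtain \<rho> where \<rho>: "\<rho> > 0" "\<And>b. norm b < \<rho> \<Longrightarrow> u z \<le> circle_mean (\<lambda>\<zeta>. u (z + \<zeta> *s b))"
    by blast
  obtain \<rho>' where "\<rho>' > 0" "ball z \<rho>' \<subseteq> N"
    using N open_contains_ball by blast
  with \<rho> show "\<exists>\<rho>>0. ball z \<rho> \<subseteq> N \<and> (\<forall>b. norm b < \<rho> \<longrightarrow> u z \<le> circle_mean (\<lambda>\<zeta>. u (z + \<zeta> *s b)))"
    by (intro exI[of _ "min \<rho> \<rho>'"]) auto
qed (auto intro: continuous_on_subset)

text \<open>The radius in \<open>psh\<close> may depend on the point, so a local representation is
  enough. All gluing arguments rest on this.\<close>

lemma psh_local:
  assumes "\<And>z. z \<in> S \<Longrightarrow> \<exists>N v. z \<in> N \<and> N \<subseteq> S \<and> psh N v \<and> (\<forall>x\<in>N. u x = v x)"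
  shows "psh S u"
  unfolding psh_def
proof (intro conjI ballI)
  show "continuous_on S u"
  proof -
    have "continuous (at z within S) u" if z: "z \<in> S" for z
    proof -
      obtain N v where N: "z \<in> N" "N \<subseteq> S" "psh N v" "\<forall>x\<in>N. u x = v x"
        using assms[OF z] by blast
      then have "continuous_on N u"
        using psh_continuous continuous_on_eq by metis
      with N have "continuous (at z) u"
        using psh_open continuous_on_eq_continuous_at by blast
      then show ?thesis by (rule continuous_at_imp_continuous_at_within)
    qed
    then show ?thesis by (simp add: continuous_on_eq_continuous_within)
  qed
  fix z assume z: "z \<in> S"
  obtain N v where N: "z \<in> N" "N \<subseteq> S" "psh N v" "\<forall>x\<in>N. u x = v x"
    using assms[OF z] by blast
  obtain \<rho> where \<rho>: "\<rho> > 0" "ball z \<rho> \<subseteq> N" "\<And>b. norm b < \<rho> \<Longrightarrow> v z \<le> circle_mean (\<lambda>\<zeta>. v (z + \<zeta> *s b))"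
    using pshE[OF N(3,1)] by metis
  have "u z \<le> circle_mean (\<lambda>\<zeta>. u (z + \<zeta> *s b))" if b: "norm b < \<rho>" for b
  proof -
    have "circle_mean (\<lambda>\<zeta>. u (z + \<zeta> *s b)) = circle_mean (\<lambda>\<zeta>. v (z + \<zeta> *s b))"
      by (intro circle_mean_cong N(4)[rule_format] subsetD[OF \<rho>(2)])
        (use b in \<open>simp add: dist_norm norm_vector_smult\<close>)
    with \<rho>(3)[OF b] N(1,4) show ?thesis by simp
  qed
  with \<rho>(1,2) N(2) show "\<exists>\<rho>>0. ball z \<rho> \<subseteq> S \<and> (\<forall>b. norm b < \<rho> \<longrightarrow> u z \<le> circle_mean (\<lambda>\<zeta>. u (z + \<zeta> *s b)))"
    by blast
qed

lemma psh_cong: "psh S u \<Longrightarrow> (\<And>x. x \<in> S \<Longrightarrow> v x = u x) \<Longrightarrow> psh S v"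
  by (rule psh_local) blast

lemma psh_affine:
  assumes "open S"
  shows "psh S (\<lambda>z. c + z \<bullet> p)"
  unfolding psh_def
proof (intro conjI ballI)
  fix z assume "z \<in> S"
  then obtain \<rho> where \<rho>: "\<rho> > 0" "ball z \<rho> \<subseteq> S"
    using assms open_contains_ball by blast
  have "circle_mean (\<lambda>\<zeta>. c + (z + \<zeta> *s b) \<bullet> p) = c + z \<bullet> p" for b
  proof -
    define \<kappa> where "\<kappa> = (\<Sum>i\<in>UNIV. b $ i * cnj (p $ i))"
    have "circle_mean (\<lambda>\<zeta>. Re (of_real (c + z \<bullet> p) + \<zeta> * \<kappa>)) = Re (of_real (c + z \<bullet> p) + 0 * \<kappa>)"
      by (rule circle_mean_Re_holomorphic) (intro continuous_intros holomorphic_intros)+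
    moreover have e: "c + (z + \<zeta> *s b) \<bullet> p = Re (of_real (c + z \<bullet> p) + \<zeta> * \<kappa>)" for \<zeta>
      unfolding inner_add_left inner_vector_smult \<kappa>_def[symmetric] by simp
    ultimately show ?thesis
      unfolding e by simp
  qed
  with \<rho> show "\<exists>\<rho>>0. ball z \<rho> \<subseteq> S \<and> (\<forall>b. norm b < \<rho> \<longrightarrow> c + z \<bullet> p \<le> circle_mean (\<lambda>\<zeta>. c + (z + \<zeta> *s b) \<bullet> p))"
    by auto
qed (intro continuous_intros)

lemma psh_const: "open S \<Longrightarrow> psh S (\<lambda>_. c)"
  using psh_affine[of S c 0] by simp

lemma psh_cmult:
  assumes "psh S u" "c \<ge> 0"
  shows "psh S (\<lambda>z. c * u z)"
  using assms unfolding psh_def circle_mean_cmult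
  by (auto intro!: continuous_intros) (meson mult_left_mono)

lemma psh_add:
  assumes u: "psh S u" and v: "psh S v"
  shows "psh S (\<lambda>z. u z + v z)"
  unfolding psh_def
proof (intro conjI ballI)
  fix z assume z: "z \<in> S"
  obtain \<rho> where \<rho>: "\<rho> > 0" "ball z \<rho> \<subseteq> S" "\<And>b. norm b < \<rho> \<Longrightarrow> u z \<le> circle_mean (\<lambda>\<zeta>. u (z + \<zeta> *s b))"
    using pshE[OF u z] by metis
  obtain \<rho>' where \<rho>': "\<rho>' > 0" "\<And>b. norm b < \<rho>' \<Longrightarrow> v z \<le> circle_mean (\<lambda>\<zeta>. v (z + \<zeta> *s b))"
    using pshE[OF v z] by metis
  have "u z + v z \<le> circle_mean (\<lambda>\<zeta>. u (z + \<zeta> *s b) + v (z + \<zeta> *s b))" if b: "norm b < min \<rho> \<rho>'" for b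
    using that \<rho>(3)[of b] \<rho>'(2)[of b]
    by (subst circle_mean_add) (auto intro!: continuous_on_affine_circle[OF _ \<rho>(2)] psh_continuous u v)
  with \<rho> \<rho>' show "\<exists>\<rho>>0. ball z \<rho> \<subseteq> S \<and> (\<forall>b. norm b < \<rho> \<longrightarrow>
      u z + v z \<le> circle_mean (\<lambda>\<zeta>. u (z + \<zeta> *s b) + v (z + \<zeta> *s b)))"
    by (intro exI[of _ "min \<rho> \<rho>'"]) auto
qed (intro continuous_intros psh_continuous u v)

lemma psh_max:
  assumes u: "psh S u" and v: "psh S v"
  shows "psh S (\<lambda>z. max (u z) (v z))"
  unfolding psh_def
proof (intro conjI ballI)
  fix z assume z: "z \<in> S"
  obtain \<rho> where \<rho>: "\<rho> > 0" "ball z \<rho> \<subseteq> S" "\<And>b. norm b < \<rho> \<Longrightarrow> u z \<le> circle_mean (\<lambda>\<zeta>. u (z + \<zeta> *s b))"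
    using pshE[OF u z] by metis
  obtain \<rho>' where \<rho>': "\<rho>' > 0" "\<And>b. norm b < \<rho>' \<Longrightarrow> v z \<le> circle_mean (\<lambda>\<zeta>. v (z + \<zeta> *s b))"
    using pshE[OF v z] by metis
  have "max (u z) (v z) \<le> circle_mean (\<lambda>\<zeta>. max (u (z + \<zeta> *s b)) (v (z + \<zeta> *s b)))"
    if b: "norm b < min \<rho> \<rho>'" for b
  proof -
    have c: "continuous_on (sphere 0 1) (\<lambda>\<zeta>. u (z + \<zeta> *s b))" "continuous_on (sphere 0 1) (\<lambda>\<zeta>. v (z + \<zeta> *s b))"
      using b by (auto intro!: continuous_on_affine_circle[OF _ \<rho>(2)] psh_continuous u v)
    have "circle_mean (\<lambda>\<zeta>. u (z + \<zeta> *s b)) \<le> circle_mean (\<lambda>\<zeta>. max (u (z + \<zeta> *s b)) (v (z + \<zeta> *s b)))"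
      "circle_mean (\<lambda>\<zeta>. v (z + \<zeta> *s b)) \<le> circle_mean (\<lambda>\<zeta>. max (u (z + \<zeta> *s b)) (v (z + \<zeta> *s b)))"
      by (intro circle_mean_mono continuous_on_max c; simp)+
    with \<rho>(3)[of b] \<rho>'(2)[of b] b show ?thesis by fastforce
  qed
  with \<rho> \<rho>' show "\<exists>\<rho>>0. ball z \<rho> \<subseteq> S \<and> (\<forall>b. norm b < \<rho> \<longrightarrow>
      max (u z) (v z) \<le> circle_mean (\<lambda>\<zeta>. max (u (z + \<zeta> *s b)) (v (z + \<zeta> *s b))))"
    by (intro exI[of _ "min \<rho> \<rho>'"]) auto
qed (intro continuous_on_max psh_continuous u v)

lemma psh_Max:
  assumes "finite I" "I \<noteq> {}" "\<And>i. i \<in> I \<Longrightarrow> psh S (h i)"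
  shows "psh S (\<lambda>z. Max ((\<lambda>i. h i z) ` I))"
  using assms
proof (induction I rule: finite_ne_induct)
  case (singleton i)
  then show ?case by simp
next
  case (insert i I)
  have "psh S (\<lambda>z. max (h i z) (Max ((\<lambda>i. h i z) ` I)))"
    using insert by (intro psh_max) auto
  then show ?case
    using insert.hyps by simp
qed

lemma psh_sum:
  assumes "finite I" "open S" "\<And>i. i \<in> I \<Longrightarrow> psh S (h i)"
  shows "psh S (\<lambda>z. \<Sum>i\<in>I. h i z)"
  using assms by (induction I rule: finite_induct) (auto intro: psh_const psh_add)

section \<open>Composition with holomorphic maps, and comparison with
  \<open>plurisubharmonic_on\<close>\<close>

lemma hol_curve_affine: "hol_curve T (\<lambda>\<zeta>. a + \<zeta> *s b)"
  unfolding hol_curve_def by (auto intro!: holomorphic_intros)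

lemma hol_curve_compose:
  fixes f :: "complex \<Rightarrow> complex^'n" and F :: "complex^'n \<Rightarrow> complex^'m"
  assumes F: "holomorphic_map U F" and f: "hol_curve T f" "open T" "f ` T \<subseteq> U"
  shows "hol_curve T (\<lambda>\<zeta>. F (f \<zeta>))"
  unfolding hol_curve_def holomorphic_on_open[OF f(2)]
proof (intro allI ballI)
  fix i \<zeta> assume \<zeta>: "\<zeta> \<in> T"
  obtain v where v: "(f has_derivative (\<lambda>h. h *s v)) (at \<zeta>)"
    using hol_curve_has_derivative[OF f(1,2) \<zeta>] by blast
  obtain D where D: "(F has_derivative D) (at (f \<zeta>))" "\<And>c v. D (c *s v) = c *s D v"
    using F f(3) \<zeta> unfolding holomorphic_map_def by (meson image_subset_iff)
  have "((\<lambda>\<zeta>. F (f \<zeta>)) has_derivative (\<lambda>h. h *s D v)) (at \<zeta>)"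
    using diff_chain_at[OF v D(1)] by (simp add: o_def D(2))
  from bounded_linear.has_derivative[OF bounded_linear_vec_nth this, of i]
  have "((\<lambda>\<zeta>. F (f \<zeta>) $ i) has_field_derivative (D v $ i)) (at \<zeta>)"
    unfolding has_field_derivative_def mult.commute[of "D v $ i"] by simp
  then show "\<exists>f'. ((\<lambda>\<zeta>. F (f \<zeta>) $ i) has_field_derivative f') (at \<zeta>)" ..
qed

lemma holomorphic_map_continuous_on: "holomorphic_map U F \<Longrightarrow> continuous_on U F"
  unfolding holomorphic_map_def
  by (meson continuous_at_imp_continuous_on has_derivative_continuous)

text \<open>\<open>F\<close> maps a small affine disc to a curved holomorphic disc, about which the
  definition of \<open>psh\<close> says nothing directly; \<open>psh_disc_mean\<close> covers it.
  The case of interest is a translation in a boundary chart.\<close>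

lemma psh_compose:
  fixes F :: "complex^'n \<Rightarrow> complex^'m"
  assumes u: "psh S u" and F: "holomorphic_map T F" "open T" "F ` T \<subseteq> S"
  shows "psh T (\<lambda>z. u (F z))"
  unfolding psh_def
proof (intro conjI ballI)
  show "continuous_on T (\<lambda>z. u (F z))"
    by (rule continuous_on_compose2[OF psh_continuous[OF u] holomorphic_map_continuous_on[OF F(1)] F(3)])
  fix z assume "z \<in> T"
  then obtain \<rho> where \<rho>: "\<rho> > 0" "ball z \<rho> \<subseteq> T"
    using F(2) open_contains_ball by blast
  have "u (F z) \<le> circle_mean (\<lambda>\<zeta>. u (F (z + \<zeta> *s b)))" if b: "norm b < \<rho>" for b
  proof -
    define A where "A = (\<lambda>\<zeta>. z + \<zeta> *s b) -` ball z \<rho>"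
    have "open A"
      unfolding A_def by (intro open_vimage open_ball continuous_intros)
    moreover have "cball 0 1 \<subseteq> A"
    proof
      fix \<zeta> :: complex assume "\<zeta> \<in> cball 0 1"
      then have "cmod \<zeta> * norm b \<le> 1 * norm b"
        by (intro mult_right_mono) auto
      with b show "\<zeta> \<in> A"
        by (simp add: A_def dist_norm norm_vector_smult)
    qed
    moreover have "hol_curve A (\<lambda>\<zeta>. F (z + \<zeta> *s b))"
      by (rule hol_curve_compose[OF F(1) hol_curve_affine \<open>open A\<close>]) (use \<rho>(2) in \<open>auto simp: A_def\<close>)
    moreover have "(\<lambda>\<zeta>. F (z + \<zeta> *s b)) ` cball 0 1 \<subseteq> S"
      using \<open>cball 0 1 \<subseteq> A\<close> \<rho>(2) F(3) by (fastforce simp: A_def)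
    ultimately show ?thesis
      using psh_disc_mean[OF u, of A "\<lambda>\<zeta>. F (z + \<zeta> *s b)"] by simp
  qed
  with \<rho> show "\<exists>\<rho>>0. ball z \<rho> \<subseteq> T \<and> (\<forall>b. norm b < \<rho> \<longrightarrow> u (F z) \<le> circle_mean (\<lambda>\<zeta>. u (F (z + \<zeta> *s b))))"
    by blast
qed

text \<open>Here the inequality is demanded on every closed disc in the set, however large, so the
  local definition has to be upgraded by \<open>psh_disc_mean\<close>, applied to an affine
  curve.\<close>

lemma psh_imp_plurisubharmonic_on:
  assumes "psh S u"
  shows "plurisubharmonic_on S u"
  unfolding plurisubharmonic_on_def
proof (intro conjI allI impI)
  fix c
  show "openin (top_of_set S) {x \<in> S. u x < c}"
  proof -
    have "{x \<in> S. u x < c} = S \<inter> u -` {..<c}"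
      by auto
    with continuous_openin_preimage_gen[OF psh_continuous[OF assms] open_lessThan[of c]] show ?thesis
      by simp
  qed
next
  fix a b assume ab: "(\<lambda>\<zeta>. a + \<zeta> *s b) ` cball 0 1 \<subseteq> S"
  have cont: "continuous_on (sphere 0 1) (\<lambda>\<zeta>. u (a + \<zeta> *s b))"
    by (rule continuous_on_compose2[OF psh_continuous[OF assms]])
      (use ab in \<open>auto intro!: continuous_intros simp: image_subset_iff\<close>)
  show "set_integrable lborel {0..2 * pi} (\<lambda>t. u (a + cis t *s b))"
    by (rule circle_mean_set_integral(1)[OF cont])
  have "u (a + 0 *s b) \<le> circle_mean (\<lambda>\<zeta>. u (a + \<zeta> *s b))"
    using psh_disc_mean[OF assms open_UNIV subset_UNIV hol_curve_affine ab] .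
  then show "u a \<le> (1 / (2 * pi)) * (LINT t:{0..2 * pi}|lborel. u (a + cis t *s b))"
    unfolding circle_mean_set_integral(2)[OF cont] by simp
qed

lemma plurisubharmonic_on_imp_psh:
  assumes "open S" "continuous_on S u" "plurisubharmonic_on S u"
  shows "psh S u"
  unfolding psh_def
proof (intro conjI ballI)
  fix z assume "z \<in> S"
  then obtain \<rho> where \<rho>: "\<rho> > 0" "ball z \<rho> \<subseteq> S"
    using assms(1) open_contains_ball by blast
  have "u z \<le> circle_mean (\<lambda>\<zeta>. u (z + \<zeta> *s b))" if b: "norm b < \<rho>" for b
  proof -
    have "(\<lambda>\<zeta>. z + \<zeta> *s b) ` cball 0 1 \<subseteq> ball z \<rho>"
    proof clarsimp
      fix \<zeta> :: complex assume "cmod \<zeta> \<le> 1"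
      then have "cmod \<zeta> * norm b \<le> 1 * norm b"
        by (intro mult_right_mono) auto
      with b show "dist z (z + \<zeta> *s b) < \<rho>"
        by (simp add: dist_norm norm_vector_smult)
    qed
    with \<rho>(2) have "u z \<le> (1 / (2 * pi)) * (LINT t:{0..2 * pi}|lborel. u (z + cis t *s b))"
      using assms(3) unfolding plurisubharmonic_on_def by blast
    then show ?thesis
      unfolding circle_mean_set_integral(2)[OF continuous_on_affine_circle[OF assms(2) \<rho>(2) b]] .
  qed
  with \<rho> show "\<exists>\<rho>>0. ball z \<rho> \<subseteq> S \<and> (\<forall>b. norm b < \<rho> \<longrightarrow> u z \<le> circle_mean (\<lambda>\<zeta>. u (z + \<zeta> *s b)))"
    by blast
qed (rule assms)

section \<open>The logarithm of the boundary distance\<close>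

definition log_dist :: "(complex^'n) set \<Rightarrow> complex^'n \<Rightarrow> real" where
  "log_dist \<Omega> z = - ln (infdist z (frontier \<Omega>))"

text \<open>A segment that leaves the set meets the frontier on its way, at a point no farther than
  its end.\<close>

lemma infdist_frontier_mem:
  fixes z :: "'a::real_normed_vector"
  assumes "z \<in> \<Omega>" "dist z y < infdist z (frontier \<Omega>)"
  shows "y \<in> \<Omega>"
proof (rule ccontr)
  assume "y \<notin> \<Omega>"
  then have "closed_segment z y \<inter> frontier \<Omega> \<noteq> {}"
    using assms(1) by (intro connected_Int_frontier) auto
  then obtain w where w: "w \<in> closed_segment z y" "w \<in> frontier \<Omega>"
    by blast
  have "infdist z (frontier \<Omega>) \<le> dist z w"
    using w(2) by (rule infdist_le)
  also have "\<dots> \<le> dist z y"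
    using segment_bound(1)[OF w(1)] by (simp add: dist_norm norm_minus_commute)
  finally show False using assms(2) by simp
qed

lemma le_infdist_frontier:
  fixes z :: "'a::real_normed_vector"
  assumes "open \<Omega>" "frontier \<Omega> \<noteq> {}" "ball z r \<subseteq> \<Omega>"
  shows "r \<le> infdist z (frontier \<Omega>)"
proof -
  have "r \<le> dist z w" if "w \<in> frontier \<Omega>" for w
    using that assms(1,3) by (force simp: frontier_def interior_open)
  then show ?thesis
    unfolding infdist_notempty[OF assms(2)] using assms(2) by (intro cINF_greatest)
qed

lemma infdist_frontier_pos:
  fixes z :: "'a::real_normed_vector"
  assumes "open \<Omega>" "frontier \<Omega> \<noteq> {}" "z \<in> \<Omega>"
  shows "infdist z (frontier \<Omega>) > 0"
proof -
  obtain r where "r > 0" "ball z r \<subseteq> \<Omega>"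
    using assms(1,3) open_contains_ball by blast
  with le_infdist_frontier[OF assms(1,2)] show ?thesis
    by force
qed

lemma exp_log_dist:
  assumes "open \<Omega>" "frontier \<Omega> \<noteq> {}" "z \<in> \<Omega>"
  shows "exp (- log_dist \<Omega> z) = infdist z (frontier \<Omega>)"
  using infdist_frontier_pos[OF assms] by (simp add: log_dist_def)

lemma continuous_on_log_dist:
  assumes "open \<Omega>" "frontier \<Omega> \<noteq> {}"
  shows "continuous_on \<Omega> (log_dist \<Omega>)"
  unfolding log_dist_def[abs_def] using infdist_frontier_pos[OF assms]
  by (intro continuous_intros) force

text \<open>
  The Kontinuitaetssatz. By the maximum principle, discs inside the domain stay in a fixed compact
  sublevel set, so the parameter can be increased from \<open>0\<close> to \<open>1\<close> in finitely many equal steps.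
\<close>

lemma psh_exhaustion_disc_family:
  fixes f h :: "complex \<Rightarrow> complex^'n"
  assumes u: "psh \<Omega> u" and comp: "\<And>c. compact {z \<in> \<Omega>. u z \<le> c}"
    and f: "hol_curve UNIV f" and h: "hol_curve UNIV h"
    and f0: "f ` cball 0 1 \<subseteq> \<Omega>"
    and bd: "\<And>\<zeta> s. cmod \<zeta> = 1 \<Longrightarrow> 0 \<le> s \<Longrightarrow> s \<le> 1 \<Longrightarrow> f \<zeta> + of_real s *s h \<zeta> \<in> \<Omega>"
  shows "f 0 + h 0 \<in> \<Omega>"
proof -
  define g where "g = (\<lambda>s \<zeta>. f \<zeta> + complex_of_real s *s h \<zeta>)"
  have g: "hol_curve UNIV (g s)" for s
    using f h unfolding hol_curve_def g_def by (auto intro!: holomorphic_intros)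
  have cf: "continuous_on A f" and ch: "continuous_on A h" for A
    using hol_curve_continuous_on[OF f] hol_curve_continuous_on[OF h] by auto
  have opO: "open \<Omega>" and contu: "continuous_on \<Omega> u"
    using u psh_open psh_continuous by auto
  \<comment> \<open>The boundary circles for all parameters are collected in one compact set, so a
    single bound \<open>m\<close> and a single sublevel set \<open>C\<close> serve for every
    \<open>s\<close>; this makes the admissible parameter step uniform.\<close>
  define K where "K = (\<lambda>(\<zeta>, s). g s \<zeta>) ` (sphere 0 1 \<times> {0..1})"
  have "continuous_on (sphere 0 1 \<times> {0..1}) (\<lambda>(\<zeta>, s). g s \<zeta>)"
    unfolding g_def case_prod_unfold
    by (intro continuous_intros continuous_on_compose2[OF cf[of UNIV]] continuous_on_compose2[OF ch[of UNIV]]) auto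
  then have "compact K"
    unfolding K_def by (intro compact_continuous_image compact_Times) auto
  moreover have "K \<subseteq> \<Omega>"
    using bd by (auto simp: K_def g_def)
  ultimately have "compact (u ` K)"
    using compact_continuous_image continuous_on_subset[OF contu] by blast
  then obtain m where m: "\<And>x. x \<in> K \<Longrightarrow> u x \<le> m"
    using compact_imp_bounded[THEN bounded_imp_bdd_above] unfolding bdd_above_def by (metis image_eqI)
  define C where "C = {z \<in> \<Omega>. u z \<le> m}"
  have inC: "g s ` cball 0 1 \<subseteq> C" if s: "0 \<le> s" "s \<le> 1" and sub: "g s ` cball 0 1 \<subseteq> \<Omega>" for s
  proof
    fix x assume "x \<in> g s ` cball 0 1"
    then obtain \<zeta>0 where \<zeta>0: "cmod \<zeta>0 \<le> 1" "x = g s \<zeta>0"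
      by auto
    have "u (g s \<zeta>0) + Re ((\<lambda>_. 0) \<zeta>0) \<le> m"
    proof (rule psh_disc_maximum_principle[OF u open_UNIV subset_UNIV g sub])
      show "u (g s \<zeta>) + Re 0 \<le> m" if "cmod \<zeta> = 1" for \<zeta>
        using m[of "g s \<zeta>"] that s unfolding K_def by force
    qed (use \<zeta>0 in auto)
    with \<zeta>0 sub show "x \<in> C"
      by (auto simp: C_def)
  qed
  have g0: "g 0 ` cball 0 1 \<subseteq> \<Omega>"
    using f0 by (simp add: g_def)
  have "g 0 0 \<in> C"
    using inC[OF _ _ g0] by auto
  then have "compact C" "C \<noteq> {}" "C \<subseteq> \<Omega>"
    using comp by (auto simp: C_def)
  then obtain \<eta> where \<eta>: "\<eta> > 0" "{x. infdist x C \<le> \<eta>} \<subseteq> \<Omega>"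
    using compact_in_open_separated[OF _ _ opO] by blast
  have "bounded (h ` cball 0 1)"
    using compact_continuous_image[OF ch compact_cball] compact_imp_bounded by blast
  then obtain B where B: "B > 0" "\<And>\<zeta>. cmod \<zeta> \<le> 1 \<Longrightarrow> norm (h \<zeta>) \<le> B"
    unfolding bounded_pos by auto
  obtain N :: nat where N: "real N > B / \<eta>"
    using reals_Archimedean2 by blast
  have N0: "N > 0"
    using N B(1) \<eta>(1) by (metis divide_pos_pos gr0I of_nat_0 order_less_asym)
  have "k \<le> N \<Longrightarrow> g (k / N) ` cball 0 1 \<subseteq> \<Omega>" for k
  proof (induction k)
    case 0
    then show ?case using g0 by simp
  next
    case (Suc k)
    have C: "g (k / N) ` cball 0 1 \<subseteq> C"
      using Suc N0 by (intro inC) auto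
    show ?case
    proof
      fix x assume "x \<in> g (Suc k / N) ` cball 0 1"
      then obtain \<zeta> where \<zeta>: "cmod \<zeta> \<le> 1" "x = g (Suc k / N) \<zeta>"
        by auto
      have "infdist x C \<le> dist x (g (k / N) \<zeta>)"
        using C \<zeta>(1) by (intro infdist_le) auto
      also have "x - g (k / N) \<zeta> = of_real (1 / N) *s h \<zeta>"
        unfolding \<zeta>(2) g_def by (simp add: vec_eq_iff add_divide_distrib distrib_right)
      then have "dist x (g (k / N) \<zeta>) = norm (h \<zeta>) / N"
        by (simp add: dist_norm norm_vector_smult norm_divide)
      also have "\<dots> \<le> B / N"
        using B(2)[OF \<zeta>(1)] by (simp add: divide_right_mono)
      also have "\<dots> \<le> \<eta>"
        using N \<eta>(1) N0 by (simp add: field_simps)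
      finally show "x \<in> \<Omega>"
        using \<eta>(2) by blast
    qed
  qed
  from this[of N] N0 have "g 1 0 \<in> \<Omega>"
    by force
  then show ?thesis
    by (simp add: g_def)
qed

text \<open>Oka's argument. Suppose Re q exceeds - log d on the boundary of an affine disc. Shifting
  the disc by exp (q 0 - q \<zeta>) times a vector shorter than exp (- Re (q 0)) moves each boundary
  point by less than its distance to the frontier. The Kontinuitaetssatz keeps the centre inside, so
  its distance to the frontier is at least exp (- Re (q 0)), and Re (q 0) is a mean that nearly
  equals that of - log d.\<close>

lemma psh_log_dist:
  fixes \<Omega> :: "(complex^'n) set"
  assumes "frontier \<Omega> \<noteq> {}" and u: "psh \<Omega> u" and comp: "\<And>c. compact {z \<in> \<Omega>. u z \<le> c}"
  shows "psh \<Omega> (log_dist \<Omega>)"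
  unfolding psh_def
proof (intro conjI ballI)
  have opO: "open \<Omega>"
    using u psh_open by auto
  note pos = infdist_frontier_pos[OF opO assms(1)]
  show cont: "continuous_on \<Omega> (log_dist \<Omega>)"
    by (rule continuous_on_log_dist[OF opO assms(1)])
  fix z assume z: "z \<in> \<Omega>"
  define \<rho> where "\<rho> = infdist z (frontier \<Omega>)"
  have sub: "ball z \<rho> \<subseteq> \<Omega>"
    using infdist_frontier_mem[OF z] by (auto simp: \<rho>_def)
  have "log_dist \<Omega> z \<le> circle_mean (\<lambda>\<zeta>. log_dist \<Omega> (z + \<zeta> *s b))" if b: "norm b < \<rho>" for b
  proof (rule field_le_epsilon)
    fix e :: real assume e: "e > 0"
    have c: "continuous_on (sphere 0 1) (\<lambda>\<zeta>. log_dist \<Omega> (z + \<zeta> *s b))"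
      by (rule continuous_on_affine_circle[OF cont sub b])
    obtain p where p: "p holomorphic_on UNIV"
      "\<And>\<zeta>. cmod \<zeta> = 1 \<Longrightarrow> \<bar>log_dist \<Omega> (z + \<zeta> *s b) - Re (p \<zeta>)\<bar> < e / 2"
      using circle_approx_holomorphic[OF c, of "e / 2"] e by auto
    \<comment> \<open>The summand \<open>e / 2\<close> puts \<open>Re (q \<zeta>)\<close> strictly
      above \<open>log_dist\<close> on the circle, but by no more than \<open>e\<close>.\<close>
    define q where "q = (\<lambda>\<zeta>. p \<zeta> + of_real (e / 2))"
    have q: "q holomorphic_on UNIV"
      unfolding q_def by (intro holomorphic_intros p(1))
    have qb: "log_dist \<Omega> (z + \<zeta> *s b) < Re (q \<zeta>)" "Re (q \<zeta>) \<le> log_dist \<Omega> (z + \<zeta> *s b) + e"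
      if "cmod \<zeta> = 1" for \<zeta>
      using p(2)[OF that] unfolding q_def plus_complex.sel Re_complex_of_real by linarith+
    have "ball z (exp (- Re (q 0))) \<subseteq> \<Omega>"
    proof
      fix y assume "y \<in> ball z (exp (- Re (q 0)))"
      then have y: "norm (y - z) < exp (- Re (q 0))"
        by (simp add: dist_norm norm_minus_commute)
      define f where "f = (\<lambda>\<zeta>. z + \<zeta> *s b)"
      \<comment> \<open>Normalised so that the shifted centre \<open>f 0 + h 0\<close> is
        \<open>y\<close>.\<close>
      define h where "h = (\<lambda>\<zeta>. exp (q 0 - q \<zeta>) *s (y - z))"
      have inb: "f \<zeta> \<in> \<Omega>" if "cmod \<zeta> \<le> 1" for \<zeta>
      proof -
        have "cmod \<zeta> * norm b \<le> 1 * norm b"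
          using that by (intro mult_right_mono) auto
        with b have "f \<zeta> \<in> ball z \<rho>"
          by (simp add: f_def dist_norm norm_vector_smult)
        with sub show ?thesis by blast
      qed
      have "f 0 + h 0 \<in> \<Omega>"
      proof (rule psh_exhaustion_disc_family[OF u comp])
        show "hol_curve UNIV f"
          unfolding f_def by (rule hol_curve_affine)
        show "hol_curve UNIV h"
          unfolding hol_curve_def h_def using q by (auto intro!: holomorphic_intros)
        show "f ` cball 0 1 \<subseteq> \<Omega>"
          using inb by auto
        fix \<zeta> :: complex and s :: real assume \<zeta>: "cmod \<zeta> = 1" and s: "0 \<le> s" "s \<le> 1"
        have "norm (of_real s *s h \<zeta>) = s * (exp (Re (q 0) - Re (q \<zeta>)) * norm (y - z))"
          unfolding h_def norm_vector_smult using s by simp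
        also have "\<dots> \<le> exp (Re (q 0) - Re (q \<zeta>)) * norm (y - z)"
          using s by (intro mult_left_le_one_le) auto
        also have "\<dots> \<le> exp (Re (q 0) - Re (q \<zeta>)) * exp (- Re (q 0))"
          using y by simp
        also have "\<dots> = exp (- Re (q \<zeta>))"
          by (simp flip: exp_add)
        also have "\<dots> < exp (- log_dist \<Omega> (f \<zeta>))"
          using qb(1)[OF \<zeta>] by (simp add: f_def)
        also have "\<dots> = infdist (f \<zeta>) (frontier \<Omega>)"
          using inb[of \<zeta>] \<zeta> by (intro exp_log_dist[OF opO assms(1)]) simp
        finally show "f \<zeta> + of_real s *s h \<zeta> \<in> \<Omega>"
          by (intro infdist_frontier_mem[OF inb[of \<zeta>]]) (use \<zeta> in \<open>auto simp: dist_norm\<close>)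
      qed
      then show "y \<in> \<Omega>"
        by (simp add: f_def h_def)
    qed
    from le_infdist_frontier[OF opO assms(1) this]
    have "exp (- Re (q 0)) \<le> exp (- log_dist \<Omega> z)"
      using exp_log_dist[OF opO assms(1) z] by simp
    then have "log_dist \<Omega> z \<le> Re (q 0)"
      by simp
    also have "Re (q 0) = circle_mean (\<lambda>\<zeta>. Re (q \<zeta>))"
      using q by (intro circle_mean_Re_holomorphic[symmetric])
        (auto intro: holomorphic_on_subset continuous_on_subset dest: holomorphic_on_imp_continuous_on)
    also have "\<dots> \<le> circle_mean (\<lambda>\<zeta>. log_dist \<Omega> (z + \<zeta> *s b) + e)"
    proof (rule circle_mean_mono)
      show "continuous_on (sphere 0 1) (\<lambda>\<zeta>. Re (q \<zeta>))"
        using q by (intro continuous_intros) (auto intro: continuous_on_subset dest: holomorphic_on_imp_continuous_on)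
    qed (auto intro!: continuous_intros c qb(2))
    also have "\<dots> = circle_mean (\<lambda>\<zeta>. log_dist \<Omega> (z + \<zeta> *s b)) + e"
      by (simp add: circle_mean_add c circle_mean_const)
    finally show "log_dist \<Omega> z \<le> circle_mean (\<lambda>\<zeta>. log_dist \<Omega> (z + \<zeta> *s b)) + e" .
  qed
  then show "\<exists>\<rho>>0. ball z \<rho> \<subseteq> \<Omega> \<and> (\<forall>b. norm b < \<rho> \<longrightarrow>
      log_dist \<Omega> z \<le> circle_mean (\<lambda>\<zeta>. log_dist \<Omega> (z + \<zeta> *s b)))"
    using pos[OF z] sub unfolding \<rho>_def by blast
qed

section \<open>Translations in boundary charts\<close>

lemma bounded_linear_smult_vector: "bounded_linear (\<lambda>\<zeta>. \<zeta> *s (e :: complex^'n))"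
  by (rule bounded_linear_intro[where K = "norm e"])
    (simp_all add: vec_eq_iff distrib_right norm_vector_smult)

text \<open>\<open>holomorphic_map\<close> gives only a pointwise derivative, so a uniform bound
  comes from Cauchy's inequality: around a point of \<open>ball p R\<close> the disc in any complex
  direction of length \<open>R\<close> stays in \<open>cball p R0\<close>, where \<open>F\<close> is
  bounded by \<open>m\<close>. The circle of radius 1/2 gives \<open>2 * m\<close> for each
  coordinate of the derivative, and summing over the coordinates yields the factor
  \<open>CARD('m)\<close>.\<close>

lemma holomorphic_map_locally_Lipschitz:
  fixes F :: "complex^'n \<Rightarrow> complex^'m"
  assumes "open U" and F: "holomorphic_map U F" and "p \<in> U"
  obtains \<rho> M where "\<rho> > 0" "M \<ge> 1" "ball p \<rho> \<subseteq> U"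
    "\<And>x y. x \<in> ball p \<rho> \<Longrightarrow> y \<in> ball p \<rho> \<Longrightarrow> norm (F x - F y) \<le> M * norm (x - y)"
proof -
  obtain R0 where R0: "R0 > 0" "cball p R0 \<subseteq> U"
    using assms(1,3) open_contains_cball by blast
  define R where "R = R0 / 2"
  have R: "R > 0" "R0 = 2 * R"
    using R0 by (auto simp: R_def)
  have "continuous_on (cball p R0) F"
    using holomorphic_map_continuous_on[OF F] R0(2) continuous_on_subset by blast
  then have "bounded (F ` cball p R0)"
    using compact_continuous_image compact_imp_bounded compact_cball by blast
  then obtain m where m: "m > 0" "\<And>x. x \<in> cball p R0 \<Longrightarrow> norm (F x) \<le> m"
    unfolding bounded_pos by auto
  obtain D where D: "\<And>x. x \<in> U \<Longrightarrow> (F has_derivative D x) (at x)"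
    "\<And>x c v. x \<in> U \<Longrightarrow> D x (c *s v) = c *s D x v"
    using F unfolding holomorphic_map_def by metis
  define M where "M = real CARD('m) * (2 * m) / R"
  have inU: "ball p R \<subseteq> U"
    using R R0(2) by (auto simp: subset_iff)
  have onorm: "onorm (D x) \<le> M" if x: "x \<in> ball p R" for x
  proof (rule onorm_le)
    fix b
    have xU: "x \<in> U"
      using x inU by auto
    show "norm (D x b) \<le> M * norm b"
    proof (cases "b = 0")
      case True
      have "D x 0 = 0"
        using D(2)[OF xU, of 0 0] by simp
      with True show ?thesis by simp
    next
      case False
      define e where "e = complex_of_real (R / norm b) *s b"
      have ne: "norm e = R"
        using False R(1) by (simp add: e_def norm_vector_smult norm_divide)
      have be: "b = complex_of_real (norm b / R) *s e"
      proof -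
        have "complex_of_real (norm b / R) * complex_of_real (R / norm b) = 1"
          unfolding of_real_mult[symmetric] using False R(1) by simp
        then show ?thesis
          unfolding e_def vector_smult_assoc by simp
      qed
      have sub: "x + \<zeta> *s e \<in> cball p R0" if "cmod \<zeta> < 1" for \<zeta>
      proof -
        have "dist p (x + \<zeta> *s e) \<le> dist p x + cmod \<zeta> * R"
          using dist_triangle[of p "x + \<zeta> *s e" x] by (simp add: dist_norm norm_vector_smult ne)
        also have "cmod \<zeta> * R \<le> 1 * R"
          using that R(1) by (intro mult_right_mono) auto
        finally show ?thesis
          using x R by simp
      qed
      have hol: "hol_curve (ball 0 1) (\<lambda>\<zeta>. F (x + \<zeta> *s e))"
        by (rule hol_curve_compose[OF F hol_curve_affine]) (use sub R0(2) in auto)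
      have "cmod (D x e $ i) \<le> 2 * m" for i
      proof -
        define h where "h = (\<lambda>\<zeta>. F (x + \<zeta> *s e) $ i)"
        have h: "h holomorphic_on ball 0 1"
          using hol by (simp add: hol_curve_def h_def)
        have "((\<lambda>\<zeta>. x + \<zeta> *s e) has_derivative (\<lambda>\<zeta>. \<zeta> *s e)) (at 0)"
          using has_derivative_add[OF has_derivative_const[of x]
              bounded_linear_imp_has_derivative[OF bounded_linear_smult_vector[of e]]] by simp
        from diff_chain_at[OF this, of F "D x"] D[OF xU]
        have "((\<lambda>\<zeta>. F (x + \<zeta> *s e)) has_derivative (\<lambda>\<zeta>. \<zeta> *s D x e)) (at 0)"
          by (simp add: o_def)
        from bounded_linear.has_derivative[OF bounded_linear_vec_nth this, of i]
        have "(h has_field_derivative (D x e $ i)) (at 0)"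
          unfolding has_field_derivative_def mult.commute[of "D x e $ i"] by (simp add: h_def)
        then have "deriv h 0 = D x e $ i"
          by (rule DERIV_imp_deriv)
        moreover have "norm ((deriv ^^ 1) h 0) \<le> fact 1 * m / (1/2) ^ 1"
        proof (rule Cauchy_inequality)
          show "h holomorphic_on ball 0 (1/2)"
            by (rule holomorphic_on_subset[OF h]) auto
          show "continuous_on (cball 0 (1/2)) h"
            by (rule continuous_on_subset[OF holomorphic_on_imp_continuous_on[OF h]]) auto
          fix \<zeta> :: complex assume "norm (0 - \<zeta>) = 1/2"
          then have "norm (F (x + \<zeta> *s e)) \<le> m"
            using sub[of \<zeta>] by (intro m(2)) auto
          then show "norm (h \<zeta>) \<le> m"
            unfolding h_def by (rule order_trans[OF Finite_Cartesian_Product.norm_nth_le])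
        qed auto
        ultimately show ?thesis by simp
      qed
      then have "norm (D x e) \<le> (\<Sum>i\<in>(UNIV :: 'm set). 2 * m)"
        unfolding norm_vec_def by (intro order_trans[OF L2_set_le_sum] sum_mono) auto
      then have "norm (D x e) \<le> real CARD('m) * (2 * m)"
        by simp
      then have "norm b / R * norm (D x e) \<le> norm b / R * (real CARD('m) * (2 * m))"
        using R(1) by (intro mult_left_mono) auto
      also have "norm b / R * norm (D x e) = norm (D x b)"
        using R(1) by (subst (2) be) (simp add: D(2)[OF xU] norm_vector_smult norm_divide)
      finally show ?thesis
        by (simp add: M_def mult.commute)
    qed
  qed
  show thesis
  proof (rule that)
    fix x y assume xy: "x \<in> ball p R" "y \<in> ball p R"
    have "norm (F x - F y) \<le> M * norm (x - y)"
    proof (rule differentiable_bound[OF convex_ball _ onorm])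
      show "(F has_derivative D w) (at w within ball p R)" if "w \<in> ball p R" for w
        using D(1)[of w] inU that has_derivative_at_withinI by blast
    qed (use xy in auto)
    also have "\<dots> \<le> max M 1 * norm (x - y)"
      by (intro mult_right_mono) auto
    finally show "norm (F x - F y) \<le> max M 1 * norm (x - y)" .
  qed (use R inU in auto)
qed

lemma norm_axis: "norm (axis k x :: 'a::real_normed_vector^'n) = norm x"
proof -
  have "(norm (axis k x $ i))\<^sup>2 = (if i = k then (norm x)\<^sup>2 else 0)" for i
    by (simp add: axis_def)
  then show ?thesis
    by (simp add: norm_vec_def L2_set_def)
qed

lemma norm_drop_Im_le: "norm (drop_Im k x) \<le> norm x"
  unfolding norm_vec_def drop_Im_def
  by (intro L2_set_mono) (auto simp: abs_Re_le_cmod)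

lemma drop_Im_diff: "drop_Im k x - drop_Im k y = drop_Im k (x - y)"
  by (simp add: vec_eq_iff drop_Im_def)

lemma Im_drop_Im [simp]: "Im (drop_Im k x $ k) = 0"
  by (simp add: drop_Im_def)

lemma holomorphic_map_compose_translate:
  assumes F: "holomorphic_map U F" and G: "holomorphic_map V G"
    and N: "N \<subseteq> U" "\<And>z. z \<in> N \<Longrightarrow> F z - a \<in> V"
  shows "holomorphic_map N (\<lambda>z. G (F z - a))"
  unfolding holomorphic_map_def
proof
  fix z assume z: "z \<in> N"
  obtain D where D: "(F has_derivative D) (at z)" "\<And>c v. D (c *s v) = c *s D v"
    using F z N(1) unfolding holomorphic_map_def by blast
  obtain E where E: "(G has_derivative E) (at (F z - a))" "\<And>c v. E (c *s v) = c *s E v"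
    using G N(2)[OF z] unfolding holomorphic_map_def by blast
  have "((\<lambda>z. F z - a) has_derivative D) (at z)"
    using has_derivative_diff[OF D(1) has_derivative_const[of a]] by simp
  from diff_chain_at[OF this E(1)]
  have "((\<lambda>z. G (F z - a)) has_derivative (\<lambda>v. E (D v))) (at z)"
    by (simp add: o_def)
  with D(2) E(2) show "\<exists>D. ((\<lambda>z. G (F z - a)) has_derivative D) (at z) \<and> (\<forall>c v. D (c *s v) = c *s D v)"
    by (intro exI[of _ "\<lambda>v. E (D v)"]) simp
qed

text \<open>
  In a chart, the translation by \<open>exp (- L)\<close> into the domain keeps a distance of order
  \<open>exp (- L / \<beta>)\<close> from the boundary.
\<close>

lemma Hoelder_boundary_chart:
  fixes \<Omega> :: "(complex^'n) set"
  assumes "open \<Omega>" "frontier \<Omega> \<noteq> {}" and psh: "psh \<Omega> (log_dist \<Omega>)"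
    and "Hoelder_boundary \<Omega>" "p \<in> frontier \<Omega>"
  obtains \<rho> B C L0 where "\<rho> > 0" "B \<ge> 1" "C \<ge> 0"
    "\<And>L. L \<ge> L0 \<Longrightarrow> \<exists>v. psh (\<Omega> \<inter> ball p \<rho>) v \<and> (\<forall>z\<in>\<Omega> \<inter> ball p \<rho>. v z \<le> B * L \<and>
        min (log_dist \<Omega> z) L - C \<le> v z \<and> (log_dist \<Omega> z \<le> L - C \<longrightarrow> v z \<le> log_dist \<Omega> z + 1))"
proof -
  obtain U V \<Phi> r k g \<beta> where
    pU: "p \<in> U" and bih: "biholomorphic_map U V \<Phi>" and \<Phi>p: "\<Phi> p = 0" and r: "r > 0" "ball 0 r \<subseteq> V"
    and \<beta>: "0 < \<beta>" "\<beta> < 1" and hoe: "Hoelder_on \<beta> {\<zeta>. Im (\<zeta> $ k) = 0 \<and> norm \<zeta> < r} g"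
    and graph: "\<Phi> ` (\<Omega> \<inter> U) \<inter> ball 0 r = {z \<in> ball 0 r. Im (z $ k) < g (drop_Im k z)}"
    using bspec[OF assms(4)[unfolded Hoelder_boundary_def] assms(5)]
    by (elim exE conjE) (rule that; assumption)
  define \<Psi> where "\<Psi> = inv_into U \<Phi>"
  have op: "open U" "open V" and bij: "bij_betw \<Phi> U V"
    and hol: "holomorphic_map U \<Phi>" "holomorphic_map V \<Psi>"
    using bih by (auto simp: biholomorphic_map_def \<Psi>_def)
  have inv1: "\<Psi> (\<Phi> x) = x" if "x \<in> U" for x
    using bij that by (simp add: \<Psi>_def bij_betw_inv_into_left)
  have inv2: "\<Phi> (\<Psi> y) = y" if "y \<in> V" for y
    using bij that by (simp add: \<Psi>_def bij_betw_inv_into_right)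
  obtain C0 where C0: "\<And>x y. x \<in> {\<zeta>. Im (\<zeta> $ k) = 0 \<and> norm \<zeta> < r} \<Longrightarrow>
      y \<in> {\<zeta>. Im (\<zeta> $ k) = 0 \<and> norm \<zeta> < r} \<Longrightarrow> \<bar>g x - g y\<bar> \<le> C0 * dist x y powr \<beta>"
    using hoe unfolding Hoelder_on_def by blast
  define C1 where "C1 = max C0 0"
  have C1: "C1 \<ge> 0"
    by (simp add: C1_def)
  have gC1: "\<bar>g (drop_Im k x) - g (drop_Im k y)\<bar> \<le> C1 * s powr \<beta>"
    if "norm x < r" "norm y < r" "norm (x - y) \<le> s" for x y s
  proof -
    have "norm (drop_Im k x) < r" "norm (drop_Im k y) < r"
      using that norm_drop_Im_le[of k x] norm_drop_Im_le[of k y] by linarith+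
    then have "\<bar>g (drop_Im k x) - g (drop_Im k y)\<bar> \<le> C0 * dist (drop_Im k x) (drop_Im k y) powr \<beta>"
      by (intro C0) auto
    also have "\<dots> \<le> C1 * dist (drop_Im k x) (drop_Im k y) powr \<beta>"
      by (intro mult_right_mono) (auto simp: C1_def)
    also have "\<dots> \<le> C1 * s powr \<beta>"
      using that(3) norm_drop_Im_le[of k "x - y"] C1 \<beta>
      by (intro mult_left_mono powr_mono2) (auto simp: dist_norm drop_Im_diff)
    finally show ?thesis .
  qed
  obtain \<rho>1 M1 where \<rho>1: "\<rho>1 > 0" "M1 \<ge> 1" "ball p \<rho>1 \<subseteq> U"
    "\<And>x y. x \<in> ball p \<rho>1 \<Longrightarrow> y \<in> ball p \<rho>1 \<Longrightarrow> norm (\<Phi> x - \<Phi> y) \<le> M1 * norm (x - y)"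
    using holomorphic_map_locally_Lipschitz[OF op(1) hol(1) pU] by metis
  have "0 \<in> V"
    using r by auto
  then obtain \<rho>2 M2 where \<rho>2: "\<rho>2 > 0" "M2 \<ge> 1" "ball 0 \<rho>2 \<subseteq> V"
    "\<And>x y. x \<in> ball 0 \<rho>2 \<Longrightarrow> y \<in> ball 0 \<rho>2 \<Longrightarrow> norm (\<Psi> x - \<Psi> y) \<le> M2 * norm (x - y)"
    using holomorphic_map_locally_Lipschitz[OF op(2) hol(2)] by metis
  define M where "M = max M1 M2"
  have M: "M \<ge> 1"
    using \<rho>1(2) by (simp add: M_def)
  have Lip\<Phi>: "norm (\<Phi> x - \<Phi> y) \<le> M * norm (x - y)" if "x \<in> ball p \<rho>1" "y \<in> ball p \<rho>1" for x y
    by (rule order_trans[OF \<rho>1(4)[OF that]]) (auto simp: M_def intro: mult_right_mono)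
  have Lip\<Psi>: "norm (\<Psi> x - \<Psi> y) \<le> M * norm (x - y)" if "norm x < \<rho>2" "norm y < \<rho>2" for x y
    by (rule order_trans[OF \<rho>2(4)]) (use that in \<open>auto simp: M_def intro: mult_right_mono\<close>)
  define r1 where "r1 = min r \<rho>2"
  have r1: "r1 > 0" "r1 \<le> r" "r1 \<le> \<rho>2"
    using r \<rho>2 by (auto simp: r1_def)
  \<comment> \<open>The image of this ball has radius at most \<open>r1 / 2\<close>, which leaves
    \<open>r1 / 4\<close> for the translation and \<open>r1 / 4\<close> for a small ball around the
    translated point.\<close>
  define \<rho> where "\<rho> = min (\<rho>1 / 4) (r1 / (2 * M))"
  have \<rho>: "\<rho> > 0" "\<rho> \<le> \<rho>1 / 4" "M * \<rho> \<le> r1 / 2"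
  proof -
    show "\<rho> > 0" "\<rho> \<le> \<rho>1 / 4"
      using M r1 \<rho>1 by (auto simp: \<rho>_def)
    have "M * \<rho> \<le> M * (r1 / (2 * M))"
      using M by (intro mult_left_mono) (auto simp: \<rho>_def)
    then show "M * \<rho> \<le> r1 / 2"
      using M by simp
  qed
  define t0 where "t0 = min 1 (min (r1 / 4) (\<rho>1 / (4 * M)))"
  have t0: "t0 > 0"
    using M r1 \<rho>1 by (simp add: t0_def)
  \<comment> \<open>A point moves by at most \<open>M * t\<close>. For the lower bound of
    \<open>v\<close> the factor \<open>1 + M\<close> would be consumed; \<open>2 + 2 * M\<close>
    also ensures that for \<phi> \<le> L - C the move is at most half the distance to the frontier,
    so that this distance at most halves, and 2 \<le> exp 1.\<close>
  define C where "C = ln (2 + 2 * M)"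
  \<comment> \<open>The radius \<open>s / M\<close> found below has - ln (s / M) = ln M + (L + ln
    (C1 + 1)) / \<beta>; since L \<ge> 1, every summand is at most a multiple of
    \<open>L\<close>.\<close>
  define B where "B = ln M + ln (C1 + 1) / \<beta> + 1 / \<beta>"
  have lnM: "ln M \<ge> 0" "ln (C1 + 1) / \<beta> \<ge> 0"
    using M C1 \<beta> by auto
  have "1 / \<beta> \<ge> 1"
    using \<beta> by simp
  with lnM have B: "B \<ge> 1"
    unfolding B_def by linarith
  have C: "C \<ge> 0"
    using M by (simp add: C_def)
  define L0 where "L0 = max 1 (- ln t0)"
  have "\<exists>v. psh (\<Omega> \<inter> ball p \<rho>) v \<and> (\<forall>z\<in>\<Omega> \<inter> ball p \<rho>. v z \<le> B * L \<and>
        min (log_dist \<Omega> z) L - C \<le> v z \<and> (log_dist \<Omega> z \<le> L - C \<longrightarrow> v z \<le> log_dist \<Omega> z + 1))"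
    if L: "L \<ge> L0" for L
  proof -
    define t where "t = exp (- L)"
    have "t \<le> exp (ln t0)"
      unfolding t_def using L by (intro iffD2[OF exp_le_cancel_iff]) (simp add: L0_def)
    then have "t \<le> t0"
      using t0 by simp
    then have t: "t > 0" "t \<le> 1" "t \<le> r1 / 4" "t \<le> \<rho>1 / (4 * M)"
      by (auto simp: t_def t0_def)
    have Mt: "M * t \<le> \<rho>1 / 4"
      using t(4) M by (simp add: field_simps)
    have t\<rho>: "t \<le> \<rho>1 / 4"
    proof -
      have "1 * t \<le> M * t"
        using M t(1) by (intro mult_right_mono) auto
      with Mt show ?thesis by linarith
    qed
    \<comment> \<open>Subtracting \<open>a\<close> lowers \<open>Im (z $ k)\<close> by
      \<open>t\<close> and leaves \<open>drop_Im k z\<close> unchanged, so the height of the graph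
      over the point stays the same.\<close>
    define a :: "complex^'n" where "a = axis k (of_real t * \<i>)"
    have na: "norm a = t"
      using t(1) by (simp add: a_def norm_axis norm_mult)
    define T where "T = (\<lambda>z. \<Psi> (\<Phi> z - a))"
    have pos: "Im (\<Phi> z $ k) < g (drop_Im k (\<Phi> z))" "norm (\<Phi> z) < r1 / 2" "norm (\<Phi> z - a) < 3 * r1 / 4"
      "T z \<in> \<Omega>" "norm (T z - z) \<le> M * t" if z: "z \<in> \<Omega> \<inter> ball p \<rho>" for z
    proof -
      have zU: "z \<in> U" "z \<in> ball p \<rho>1"
        using z \<rho> \<rho>1 by (auto simp: subset_iff)
      have "norm (\<Phi> z - \<Phi> p) \<le> M * norm (z - p)"
        using zU \<rho>1(1) by (intro Lip\<Phi>) auto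
      also have "\<dots> < M * \<rho>"
        using z M by (intro mult_strict_left_mono) (auto simp: dist_norm norm_minus_commute)
      finally show n: "norm (\<Phi> z) < r1 / 2"
        using \<rho>(3) \<Phi>p by simp
      have "\<Phi> z \<in> \<Phi> ` (\<Omega> \<inter> U) \<inter> ball 0 r"
        using z zU n r1 by auto
      then show im: "Im (\<Phi> z $ k) < g (drop_Im k (\<Phi> z))"
        unfolding graph by simp
      show n': "norm (\<Phi> z - a) < 3 * r1 / 4"
        using norm_triangle_ineq4[of "\<Phi> z" a] n na t(3) by linarith
      have "drop_Im k (\<Phi> z - a) = drop_Im k (\<Phi> z)"
        by (simp add: drop_Im_def vec_eq_iff a_def axis_def)
      moreover have "Im ((\<Phi> z - a) $ k) = Im (\<Phi> z $ k) - t"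
        by (simp add: a_def)
      ultimately have "\<Phi> z - a \<in> \<Phi> ` (\<Omega> \<inter> U) \<inter> ball 0 r"
        unfolding graph using im n' r1 t(1) by simp
      then show "T z \<in> \<Omega>"
        using inv1 by (auto simp: T_def)
      have "norm (\<Psi> (\<Phi> z - a) - \<Psi> (\<Phi> z)) \<le> M * norm ((\<Phi> z - a) - \<Phi> z)"
        using n n' r1 by (intro Lip\<Psi>) auto
      then show "norm (T z - z) \<le> M * t"
        using inv1[OF zU(1)] na by (simp add: T_def)
    qed
    \<comment> \<open>Chosen so that \<open>(C1 + 1) * s powr \<beta> = t\<close>. Within distance
      \<open>s\<close> the graph oscillates by at most \<open>C1 * s powr \<beta>\<close> and the
      imaginary part by \<open>s \<le> s powr \<beta>\<close>, together no more than the translation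
      \<open>t\<close>.\<close>
    define s where "s = (t / (C1 + 1)) powr (1 / \<beta>)"
    have tC: "0 < t / (C1 + 1)" "t / (C1 + 1) \<le> t"
      using t C1 by (auto simp: field_simps)
    have s\<beta>: "s powr \<beta> = t / (C1 + 1)"
      using \<beta> tC C1 by (simp add: s_def powr_powr)
    have s: "s > 0" "s \<le> t"
    proof -
      show "s > 0" using t(1) C1 by (simp add: s_def)
      have "s \<le> (t / (C1 + 1)) powr 1"
        unfolding s_def using tC t(2) \<open>1 / \<beta> \<ge> 1\<close> by (intro powr_mono') auto
      with tC C1 show "s \<le> t" by simp
    qed
    have ss: "s \<le> s powr \<beta>"
    proof -
      have "s powr 1 \<le> s powr \<beta>"
        using s t(2) \<beta> by (intro powr_mono') auto
      with s show ?thesis by simp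
    qed
    have sM: "s / M \<le> s"
      using s M by (simp add: field_simps)
    have deep: "ball (T z) (s / M) \<subseteq> \<Omega>" if z: "z \<in> \<Omega> \<inter> ball p \<rho>" for z
    proof
      fix y assume "y \<in> ball (T z) (s / M)"
      then have y: "norm (y - T z) < s / M"
        by (simp add: dist_norm norm_minus_commute)
      have zp: "norm (z - p) < \<rho>"
        using z by (simp add: dist_norm norm_minus_commute)
      have "norm (T z - p) \<le> norm (T z - z) + norm (z - p)"
        using norm_triangle_ineq[of "T z - z" "z - p"] by simp
      then have Tp: "norm (T z - p) < \<rho>1 / 2"
        using pos(5)[OF z] zp \<rho>(2) Mt by linarith
      have "norm (y - p) \<le> norm (y - T z) + norm (T z - p)"
        using norm_triangle_ineq[of "y - T z" "T z - p"] by simp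
      then have "norm (y - p) < \<rho>1"
        using Tp y sM s(2) t\<rho> \<rho>1(1) by linarith
      then have in\<rho>: "y \<in> ball p \<rho>1" "T z \<in> ball p \<rho>1"
        using Tp \<rho>1(1) by (auto simp: dist_norm norm_minus_commute)
      then have yU: "y \<in> U"
        using \<rho>1(3) by auto
      have inr: "norm (\<Phi> z - a) < r" "norm (\<Phi> z) < r"
        using pos(2,3)[OF z] r1 by linarith+
      have "\<Phi> (T z) = \<Phi> z - a"
        unfolding T_def using inr r(2) by (intro inv2) (auto simp: subset_iff)
      then have "norm (\<Phi> y - (\<Phi> z - a)) \<le> M * norm (y - T z)"
        using Lip\<Phi>[OF in\<rho>] by simp
      also have "\<dots> < M * (s / M)"
        using y M by (intro mult_strict_left_mono) auto
      finally have close: "norm (\<Phi> y - (\<Phi> z - a)) < s"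
        using M by simp
      have "norm (\<Phi> y) \<le> norm (\<Phi> y - (\<Phi> z - a)) + norm (\<Phi> z - a)"
        using norm_triangle_ineq[of "\<Phi> y - (\<Phi> z - a)" "\<Phi> z - a"] by simp
      then have ny: "norm (\<Phi> y) < r"
        using close pos(3)[OF z] s(2) t(3) r1(2) by linarith
      have "drop_Im k (\<Phi> z - a) = drop_Im k (\<Phi> z)"
        by (simp add: drop_Im_def vec_eq_iff a_def axis_def)
      with gC1[OF ny inr(1), of s] close
      have g: "g (drop_Im k (\<Phi> z)) \<le> g (drop_Im k (\<Phi> y)) + C1 * s powr \<beta>"
        by auto
      have "Im ((\<Phi> y - (\<Phi> z - a)) $ k) \<le> cmod ((\<Phi> y - (\<Phi> z - a)) $ k)"
        using abs_Im_le_cmod[of "(\<Phi> y - (\<Phi> z - a)) $ k"] by linarith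
      also have "\<dots> \<le> norm (\<Phi> y - (\<Phi> z - a))"
        by (rule Finite_Cartesian_Product.norm_nth_le)
      finally have "Im (\<Phi> y $ k) < Im (\<Phi> z $ k) - t + s"
        using close by (simp add: a_def)
      also have "\<dots> < g (drop_Im k (\<Phi> y)) + (C1 * s powr \<beta> + s powr \<beta>) - t"
        using g pos(1)[OF z] ss by linarith
      also have "C1 * s powr \<beta> + s powr \<beta> = t"
      proof -
        have "C1 * s powr \<beta> + s powr \<beta> = (C1 + 1) * (t / (C1 + 1))"
          by (simp only: s\<beta> distrib_right mult_1_left)
        with C1 show ?thesis by simp
      qed
      finally have "\<Phi> y \<in> \<Phi> ` (\<Omega> \<inter> U) \<inter> ball 0 r"
        unfolding graph using ny by simp
      then obtain y' where "y' \<in> \<Omega> \<inter> U" "\<Phi> y = \<Phi> y'"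
        by auto
      then show "y \<in> \<Omega>"
        using inv1[of y'] inv1[OF yU] by auto
    qed
    define v where "v = (\<lambda>z. log_dist \<Omega> (T z))"
    show ?thesis
    proof (intro exI conjI ballI impI)
      show "psh (\<Omega> \<inter> ball p \<rho>) v"
        unfolding v_def
      proof (rule psh_compose[OF psh])
        show "holomorphic_map (\<Omega> \<inter> ball p \<rho>) T"
          unfolding T_def
        proof (rule holomorphic_map_compose_translate[OF hol])
          show "\<Omega> \<inter> ball p \<rho> \<subseteq> U"
            using \<rho> \<rho>1 by (auto simp: subset_iff)
          show "\<Phi> z - a \<in> V" if "z \<in> \<Omega> \<inter> ball p \<rho>" for z
            using pos(3)[OF that] r1 r by (auto simp: subset_iff)
        qed
        show "T ` (\<Omega> \<inter> ball p \<rho>) \<subseteq> \<Omega>"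
          using pos(4) by auto
      qed (use assms(1) in auto)
      fix z assume z: "z \<in> \<Omega> \<inter> ball p \<rho>"
      then have z\<Omega>: "z \<in> \<Omega>" by simp
      note el = exp_log_dist[OF assms(1,2)]
      have dist: "dist z (T z) \<le> M * t"
        using pos(5)[OF z] by (simp add: dist_norm norm_minus_commute)
      have d1: "exp (- v z) \<le> exp (- log_dist \<Omega> z) + M * t"
        unfolding v_def el[OF z\<Omega>] el[OF pos(4)[OF z]]
        using infdist_triangle[of "T z" "frontier \<Omega>" z] dist by (simp add: dist_commute)
      have d2: "exp (- log_dist \<Omega> z) \<le> exp (- v z) + M * t"
        unfolding v_def el[OF z\<Omega>] el[OF pos(4)[OF z]]
        using infdist_triangle[of z "frontier \<Omega>" "T z"] dist by simp
      have "s / M \<le> exp (- v z)"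
        unfolding v_def el[OF pos(4)[OF z]] by (rule le_infdist_frontier[OF assms(1,2) deep[OF z]])
      then have "ln (s / M) \<le> - v z"
        using s M by (subst (asm) ln_le_cancel_iff[symmetric]) auto
      moreover have "ln (s / M) = (1 / \<beta>) * (- L - ln (C1 + 1)) - ln M"
        using s M t C1 tC by (simp add: ln_div s_def ln_powr t_def)
      ultimately have "v z \<le> ln M - (1 / \<beta>) * (- L - ln (C1 + 1))"
        by linarith
      also have "\<dots> = ln M * 1 + ln (C1 + 1) / \<beta> * 1 + 1 / \<beta> * L"
        by (simp add: diff_divide_distrib)
      also have "\<dots> \<le> ln M * L + ln (C1 + 1) / \<beta> * L + 1 / \<beta> * L"
        using L lnM \<beta> by (intro add_mono mult_left_mono) (auto simp: L0_def)
      finally show "v z \<le> B * L"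
        by (simp add: B_def distrib_right)
      show "min (log_dist \<Omega> z) L - C \<le> v z"
      proof -
        define \<mu> where "\<mu> = min (log_dist \<Omega> z) L"
        have "exp (- log_dist \<Omega> z) \<le> exp (- \<mu>)" "t \<le> exp (- \<mu>)"
          by (auto simp: \<mu>_def t_def)
        then have "exp (- v z) \<le> exp (- \<mu>) + M * exp (- \<mu>)"
          using d1 M mult_left_mono[of t "exp (- \<mu>)" M] by linarith
        also have "\<dots> = (1 + M) * exp (- \<mu>)"
          by (simp add: distrib_right)
        also have "\<dots> \<le> exp C * exp (- \<mu>)"
          using M by (intro mult_right_mono) (auto simp: C_def)
        also have "\<dots> = exp (C - \<mu>)"
          by (simp flip: exp_add)
        finally show ?thesis
          by (simp add: \<mu>_def)
      qed
      assume "log_dist \<Omega> z \<le> L - C"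
      then have "exp (C - L) \<le> exp (- log_dist \<Omega> z)"
        by simp
      moreover have "exp (C - L) = (2 + 2 * M) * t"
        using M by (simp add: exp_diff C_def t_def exp_minus field_simps)
      ultimately have "2 * (M * t) \<le> exp (- log_dist \<Omega> z)"
        using t(1) by (simp add: algebra_simps)
      then have "exp (- log_dist \<Omega> z) \<le> 2 * exp (- v z)"
        using d2 by linarith
      also have "\<dots> \<le> exp 1 * exp (- v z)"
        using exp_ge_add_one_self[of 1] by (intro mult_right_mono) auto
      also have "\<dots> = exp (1 - v z)"
        by (simp flip: exp_add)
      finally show "v z \<le> log_dist \<Omega> z + 1"
        by simp
    qed
  qed
  with \<rho>(1) B C that show thesis by blast
qed

section \<open>Barriers\<close>

text \<open>A plurisubharmonic step in \<phi> at scale \<open>L\<close>, with constants uniform in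
  \<open>L\<close> so that steps at different scales can be combined. The flat part extends to
  \<open>2 * L\<close> to leave a zone between \<open>L\<close> and \<open>2 * L\<close> for
  gluing.\<close>

definition barrier :: "(complex^'n) set \<Rightarrow> (complex^'n \<Rightarrow> real) \<Rightarrow> real \<Rightarrow> real \<Rightarrow> real \<Rightarrow> bool" where
  "barrier X \<phi> \<theta> A L0 \<longleftrightarrow> (\<forall>L\<ge>L0. \<exists>\<psi>. psh X \<psi> \<and> (\<forall>z\<in>X. - 1 \<le> \<psi> z \<and> \<psi> z \<le> 0 \<and>
     (\<phi> z \<le> 2 * L \<longrightarrow> \<psi> z = - 1) \<and> (A * L \<le> \<phi> z \<longrightarrow> - \<theta> \<le> \<psi> z)))"

lemma barrier_mono:
  assumes "barrier X \<phi> \<theta> A L0" "\<theta> \<le> \<theta>'" "A \<le> A'" "L0 \<le> L0'" "0 \<le> L0"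
  shows "barrier X \<phi> \<theta>' A' L0'"
  unfolding barrier_def
proof (intro allI impI)
  fix L assume L: "L0' \<le> L"
  then have "L0 \<le> L"
    using assms(4) by simp
  then obtain \<psi> where \<psi>: "psh X \<psi>" "\<And>z. z \<in> X \<Longrightarrow> - 1 \<le> \<psi> z \<and> \<psi> z \<le> 0 \<and>
     (\<phi> z \<le> 2 * L \<longrightarrow> \<psi> z = - 1) \<and> (A * L \<le> \<phi> z \<longrightarrow> - \<theta> \<le> \<psi> z)"
    using assms(1) unfolding barrier_def by blast
  have "A * L \<le> A' * L"
    using assms L by (intro mult_right_mono) auto
  with \<psi> assms(2) show "\<exists>\<psi>. psh X \<psi> \<and> (\<forall>z\<in>X. - 1 \<le> \<psi> z \<and> \<psi> z \<le> 0 \<and>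
     (\<phi> z \<le> 2 * L \<longrightarrow> \<psi> z = - 1) \<and> (A' * L \<le> \<phi> z \<longrightarrow> - \<theta>' \<le> \<psi> z))"
    by (intro exI[of _ \<psi>]) force
qed

lemma barrier_subset:
  assumes "barrier X \<phi> \<theta> A L0" "open Y" "Y \<subseteq> X"
  shows "barrier Y \<phi> \<theta> A L0"
  using assms unfolding barrier_def by (meson psh_subset subsetD)

lemma barrier_of_chart:
  assumes "B \<ge> 1" "C \<ge> 0" and opX: "open X"
    and chart: "\<And>L. L \<ge> L0 \<Longrightarrow> \<exists>v. psh X v \<and> (\<forall>z\<in>X. v z \<le> B * L \<and>
        min (\<phi> z) L - C \<le> v z \<and> (\<phi> z \<le> L - C \<longrightarrow> v z \<le> \<phi> z + 1))"
  obtains \<theta> L1 where "0 \<le> \<theta>" "\<theta> < 1" "L1 > 0" "barrier X \<phi> \<theta> 12 L1"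
proof -
  \<comment> \<open>The chart function of level \<open>12 * L\<close> is divided by its upper bound
    \<open>c = B * (12 * L)\<close>. It is at most 3 L = c / (4 B) where \<phi> \<le> 2 L, and at
    least 6 L = c / (2 B) where \<phi> \<ge> 12 L. Dividing by \<open>\<delta>\<close> moves the low
    value to - 1, and the gap between the two fractions makes \<open>\<theta> < 1\<close>.\<close>
  define \<delta> where "\<delta> = 1 - 1 / (4 * B)"
  define \<theta> where "\<theta> = (1 - 1 / (2 * B)) / \<delta>"
  define L1 where "L1 = max (max 1 L0) C"
  have \<delta>: "\<delta> > 0" "1 - 1 / (2 * B) < \<delta>" "1 / (2 * B) \<le> 1"
    using assms(1) by (auto simp: \<delta>_def field_simps)
  have "barrier X \<phi> \<theta> 12 L1"
    unfolding barrier_def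
  proof (intro allI impI)
    fix L assume "L1 \<le> L"
    then have L: "L \<ge> 1" "L \<ge> L0" "L \<ge> C"
      by (auto simp: L1_def)
    then have "12 * L \<ge> L0" by linarith
    from chart[OF this] obtain v where v: "psh X v" and vz: "\<And>z. z \<in> X \<Longrightarrow> v z \<le> B * (12 * L)"
      "\<And>z. z \<in> X \<Longrightarrow> min (\<phi> z) (12 * L) - C \<le> v z"
      "\<And>z. z \<in> X \<Longrightarrow> \<phi> z \<le> 12 * L - C \<Longrightarrow> v z \<le> \<phi> z + 1"
      by blast
    define c where "c = B * (12 * L)"
    have c: "c > 0"
      using assms(1) L by (simp add: c_def)
    define \<psi> where "\<psi> = (\<lambda>z. max (- 1) ((v z / c - 1) / \<delta>))"
    have "psh X (\<lambda>z. max (- 1) (1 / (c * \<delta>) * v z + (- 1 / \<delta>)))"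
      using c \<delta> by (intro psh_max psh_add psh_const psh_cmult v opX) auto
    then have "psh X \<psi>"
      by (rule psh_cong) (use c \<delta> in \<open>simp add: \<psi>_def field_simps\<close>)
    moreover have "- 1 \<le> \<psi> z \<and> \<psi> z \<le> 0 \<and>
     (\<phi> z \<le> 2 * L \<longrightarrow> \<psi> z = - 1) \<and> (12 * L \<le> \<phi> z \<longrightarrow> - \<theta> \<le> \<psi> z)" if z: "z \<in> X" for z
    proof (intro conjI impI)
      have "v z / c \<le> 1"
        using vz(1)[OF z] c by (simp add: c_def)
      then show "\<psi> z \<le> 0"
        using \<delta> by (simp add: \<psi>_def divide_nonpos_pos)
    next
      assume low: "\<phi> z \<le> 2 * L"
      then have "v z \<le> 3 * L"
        using vz(3)[OF z] L by linarith
      then have "v z / c \<le> 3 * L / c"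
        using c by (simp add: divide_right_mono)
      also have "3 * L / c = 1 / (4 * B)"
        using L assms(1) by (simp add: c_def)
      finally have "v z / c - 1 \<le> - \<delta>"
        by (simp add: \<delta>_def)
      then have "(v z / c - 1) / \<delta> \<le> - \<delta> / \<delta>"
        using \<delta> by (intro divide_right_mono) auto
      then show "\<psi> z = - 1"
        using \<delta> by (simp add: \<psi>_def)
    next
      assume "12 * L \<le> \<phi> z"
      then have "6 * L \<le> v z"
        using vz(2)[OF z] L by (simp add: min_def split: if_splits)
      then have "6 * L / c \<le> v z / c"
        using c by (simp add: divide_right_mono)
      moreover have "6 * L / c = 1 / (2 * B)"
        using L assms(1) by (simp add: c_def)
      ultimately have "- (1 - 1 / (2 * B)) / \<delta> \<le> (v z / c - 1) / \<delta>"
        using \<delta> by (intro divide_right_mono) auto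
      then show "- \<theta> \<le> \<psi> z"
        unfolding \<psi>_def \<theta>_def minus_divide_left by (rule max.coboundedI2)
    qed (simp add: \<psi>_def)
    ultimately show "\<exists>\<psi>. psh X \<psi> \<and> (\<forall>z\<in>X. - 1 \<le> \<psi> z \<and> \<psi> z \<le> 0 \<and>
     (\<phi> z \<le> 2 * L \<longrightarrow> \<psi> z = - 1) \<and> (12 * L \<le> \<phi> z \<longrightarrow> - \<theta> \<le> \<psi> z))"
      by blast
  qed
  moreover have "0 \<le> \<theta>" "\<theta> < 1" "L1 > 0"
    using \<delta> by (auto simp: \<theta>_def L1_def)
  ultimately show thesis
    using that by blast
qed

text \<open>Where L < \<phi> \<le> 2 L the maximum is just \<open>u\<close>. So one formula holds on
  the open set \<phi> < 2 L and the other on L < \<phi>, and these two sets cover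
  \<open>X\<close>.\<close>

lemma psh_glue_above:
  fixes \<phi> :: "complex^'n \<Rightarrow> real"
  assumes \<phi>: "continuous_on X \<phi>" and u: "psh X u" and v: "psh {z \<in> X. L < \<phi> z} v"
    and L: "L > 0" and le: "\<And>z. z \<in> X \<Longrightarrow> L < \<phi> z \<Longrightarrow> \<phi> z \<le> 2 * L \<Longrightarrow> v z \<le> u z"
  shows "psh X (\<lambda>z. if \<phi> z \<le> L then u z else max (u z) (v z))"
proof (rule psh_local)
  fix z assume z: "z \<in> X"
  have opX: "open X"
    using u psh_open by auto
  show "\<exists>N w. z \<in> N \<and> N \<subseteq> X \<and> psh N w \<and> (\<forall>x\<in>N. (if \<phi> x \<le> L then u x else max (u x) (v x)) = w x)"
  proof (cases "\<phi> z < 2 * L")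
    case True
    have "X \<inter> \<phi> -` {..<2 * L} = {x \<in> X. \<phi> x < 2 * L}"
      by auto
    then have "open {x \<in> X. \<phi> x < 2 * L}"
      using continuous_open_preimage[OF \<phi> opX, of "{..<2 * L}"] by simp
    then have "psh {x \<in> X. \<phi> x < 2 * L} u"
      by (rule psh_subset[OF u]) auto
    with True z le show ?thesis
      by (intro exI[of _ "{x \<in> X. \<phi> x < 2 * L}"] exI[of _ u]) (auto simp: max_def intro: antisym)
  next
    case False
    have "psh {x \<in> X. L < \<phi> x} (\<lambda>x. max (u x) (v x))"
      by (intro psh_max v psh_subset[OF u] psh_open[OF v]) auto
    with False z L show ?thesis
      by (intro exI[of _ "{x \<in> X. L < \<phi> x}"] exI[of _ "\<lambda>x. max (u x) (v x)"]) auto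
  qed
qed

text \<open>The second barrier is used at scale \<open>A1 * L\<close>, where the first has already
  risen to \<open>- \<theta>1\<close>. Multiplied by \<open>\<theta>1\<close> it starts at
  \<open>- \<theta>1\<close>, hence not above the first, and ends at
  \<open>- (\<theta>1 * \<theta>2)\<close> or higher.\<close>

lemma barrier_compose:
  assumes \<phi>: "continuous_on X \<phi>" and opX: "open X"
    and b1: "barrier X \<phi> \<theta>1 A1 L0" and b2: "barrier X \<phi> \<theta>2 A2 L0"
    and A: "A1 \<ge> 2" "A2 \<ge> 2" and \<theta>1: "0 \<le> \<theta>1" "\<theta>1 \<le> 1" and L0: "L0 > 0"
  shows "barrier X \<phi> (\<theta>1 * \<theta>2) (A1 * A2) L0"
  unfolding barrier_def
proof (intro allI impI)
  fix L assume L: "L0 \<le> L"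
  define L' where "L' = A1 * L"
  have "2 * L \<le> L'"
    using A L L0 by (simp add: L'_def)
  then have L': "2 * L \<le> L'" "L0 \<le> L'" "L' > 0"
    using L L0 by linarith+
  obtain \<psi>1 where \<psi>1: "psh X \<psi>1" and \<psi>1z: "\<And>z. z \<in> X \<Longrightarrow> - 1 \<le> \<psi>1 z \<and> \<psi>1 z \<le> 0 \<and>
     (\<phi> z \<le> 2 * L \<longrightarrow> \<psi>1 z = - 1) \<and> (L' \<le> \<phi> z \<longrightarrow> - \<theta>1 \<le> \<psi>1 z)"
    using b1 L unfolding barrier_def L'_def by metis
  obtain \<psi>2 where \<psi>2: "psh X \<psi>2" and \<psi>2z: "\<And>z. z \<in> X \<Longrightarrow> - 1 \<le> \<psi>2 z \<and> \<psi>2 z \<le> 0 \<and>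
     (\<phi> z \<le> 2 * L' \<longrightarrow> \<psi>2 z = - 1) \<and> (A2 * L' \<le> \<phi> z \<longrightarrow> - \<theta>2 \<le> \<psi>2 z)"
    using b2 L' unfolding barrier_def by metis
  define \<psi> where "\<psi> = (\<lambda>z. if \<phi> z \<le> L' then \<psi>1 z else max (\<psi>1 z) (\<theta>1 * \<psi>2 z))"
  have op: "open {z \<in> X. L' < \<phi> z}"
    using continuous_open_preimage[OF \<phi> opX, of "{L'<..}"]
    by (auto simp: Int_def vimage_def)
  have "psh X \<psi>"
    unfolding \<psi>_def
  proof (rule psh_glue_above[OF \<phi> \<psi>1 _ L'(3)])
    show "psh {z \<in> X. L' < \<phi> z} (\<lambda>z. \<theta>1 * \<psi>2 z)"
      by (intro psh_cmult psh_subset[OF \<psi>2] op \<theta>1) auto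
    show "\<theta>1 * \<psi>2 z \<le> \<psi>1 z" if "z \<in> X" "L' < \<phi> z" "\<phi> z \<le> 2 * L'" for z
      using that \<psi>1z[OF that(1)] \<psi>2z[OF that(1)] by auto
  qed
  moreover have "- 1 \<le> \<psi> z \<and> \<psi> z \<le> 0 \<and>
     (\<phi> z \<le> 2 * L \<longrightarrow> \<psi> z = - 1) \<and> (A1 * A2 * L \<le> \<phi> z \<longrightarrow> - (\<theta>1 * \<theta>2) \<le> \<psi> z)" if z: "z \<in> X" for z
  proof (intro conjI impI)
    show "- 1 \<le> \<psi> z"
      using \<psi>1z[OF z] by (auto simp: \<psi>_def)
    show "\<psi> z \<le> 0"
      using \<psi>1z[OF z] \<psi>2z[OF z] \<theta>1 by (auto simp: \<psi>_def mult_nonneg_nonpos)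
    show "\<psi> z = - 1" if "\<phi> z \<le> 2 * L"
      using that L' \<psi>1z[OF z] by (simp add: \<psi>_def)
    assume "A1 * A2 * L \<le> \<phi> z"
    then have *: "A2 * L' \<le> \<phi> z"
      by (simp add: L'_def mult_ac)
    moreover have "2 * L' \<le> A2 * L'"
      using A L' by (intro mult_right_mono) auto
    ultimately have "\<not> \<phi> z \<le> L'"
      using L' by linarith
    moreover have "\<theta>1 * (- \<theta>2) \<le> \<theta>1 * \<psi>2 z"
      using * \<psi>2z[OF z] \<theta>1 by (intro mult_left_mono) auto
    ultimately show "- (\<theta>1 * \<theta>2) \<le> \<psi> z"
      by (simp add: \<psi>_def)
  qed
  ultimately show "\<exists>\<psi>. psh X \<psi> \<and> (\<forall>z\<in>X. - 1 \<le> \<psi> z \<and> \<psi> z \<le> 0 \<and>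
     (\<phi> z \<le> 2 * L \<longrightarrow> \<psi> z = - 1) \<and> (A1 * A2 * L \<le> \<phi> z \<longrightarrow> - (\<theta>1 * \<theta>2) \<le> \<psi> z))"
    by blast
qed

text \<open>Composing a barrier with itself raises \<open>\<theta>\<close> and \<open>A\<close> to
  the same power and keeps the threshold \<open>L0\<close>; a small \<open>\<eta>\<close> is paid
  for by a large \<open>A'\<close> alone.\<close>

lemma barrier_arbitrarily_good:
  assumes \<phi>: "continuous_on X \<phi>" and opX: "open X"
    and b: "barrier X \<phi> \<theta> A L0" and A: "A \<ge> 2" and \<theta>: "0 \<le> \<theta>" "\<theta> < 1" and L0: "L0 > 0"
    and \<eta>: "\<eta> > 0"
  obtains A' where "A' \<ge> 2" "barrier X \<phi> \<eta> A' L0"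
proof -
  have pow: "barrier X \<phi> (\<theta> ^ Suc m) (A ^ Suc m) L0 \<and> A ^ Suc m \<ge> 2" for m
  proof (induction m)
    case 0
    then show ?case using b A by simp
  next
    case (Suc m)
    have "barrier X \<phi> (\<theta> * \<theta> ^ Suc m) (A * A ^ Suc m) L0"
      using Suc A \<theta> L0 by (intro barrier_compose[OF \<phi> opX b]) auto
    moreover have "A * A ^ Suc m \<ge> 2 * 1"
      using Suc A by (intro mult_mono) auto
    ultimately show ?case by simp
  qed
  obtain m where "\<theta> ^ m < \<eta>"
    using real_arch_pow_inv[OF \<eta> \<theta>(2)] by blast
  moreover have "\<theta> ^ Suc m \<le> \<theta> ^ m"
    using \<theta> by (intro power_decreasing) auto
  ultimately have "barrier X \<phi> \<eta> (A ^ Suc m) L0"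
    using L0 by (intro barrier_mono[OF conjunct1[OF pow[of m]]]) auto
  with pow[of m] show thesis
    using that by blast
qed

text \<open>
  Averaging barriers at \<open>m\<close> successive scales makes the values in different charts comparable:
  at each point at most one of the \<open>m\<close> summands is not within \<open>\<eta>\<close> of a value prescribed by \<open>\<phi>\<close>.
\<close>

definition stairs :: "real \<Rightarrow> nat \<Rightarrow> real \<Rightarrow> real \<Rightarrow> real" where
  "stairs A m L x = real (card {i. i < m \<and> A ^ Suc i * L \<le> x}) / real m - 1"

lemma stairs_low:
  assumes "A > 2" "L > 0" "x \<le> 2 * L"
  shows "stairs A m L x = - 1"
proof -
  have "\<not> A ^ Suc i * L \<le> x" for i
  proof -
    have "A * 1 * L \<le> A * A ^ i * L"
      using assms by (intro mult_right_mono mult_left_mono one_le_power) auto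
    moreover have "2 * L < A * L"
      using assms by simp
    ultimately show ?thesis using assms(3) by simp
  qed
  then show ?thesis by (simp add: stairs_def)
qed

lemma stairs_high:
  assumes "A > 2" "L > 0" "m > 0" "A ^ m * L \<le> x"
  shows "stairs A m L x = 0"
proof -
  have "A ^ Suc i * L \<le> x" if "i < m" for i
  proof -
    have "A ^ Suc i * L \<le> A ^ m * L"
      using assms that by (intro mult_right_mono power_increasing) auto
    with assms show ?thesis by linarith
  qed
  then have "{i. i < m \<and> A ^ Suc i * L \<le> x} = {..<m}"
    by auto
  with assms show ?thesis by (simp add: stairs_def)
qed

lemma stairs_le_0: "stairs A m L x \<le> 0"
proof -
  have "card {i. i < m \<and> A ^ Suc i * L \<le> x} \<le> card {..<m}"
    by (intro card_mono) auto
  then show ?thesis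
    by (cases "m = 0") (auto simp: stairs_def)
qed

lemma barrier_stairs:
  assumes opX: "open X" and b: "barrier X \<phi> \<eta> A L0" and A: "A > 2" and m: "m > 0"
    and L: "L0 \<le> L" "L0 > 0" and \<eta>: "\<eta> \<ge> 0"
  obtains \<Psi> where "psh X \<Psi>"
    "\<And>z. z \<in> X \<Longrightarrow> stairs A m L (\<phi> z) - \<eta> \<le> \<Psi> z \<and> \<Psi> z \<le> stairs A m L (\<phi> z) + 1 / m"
proof -
  have AL: "L0 \<le> A ^ i * L" for i
  proof -
    have "1 * L \<le> A ^ i * L"
      using A L by (intro mult_right_mono one_le_power) auto
    with L show ?thesis by linarith
  qed
  have "\<forall>i. \<exists>\<psi>. psh X \<psi> \<and> (\<forall>z\<in>X. - 1 \<le> \<psi> z \<and> \<psi> z \<le> 0 \<and>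
     (\<phi> z \<le> 2 * (A ^ i * L) \<longrightarrow> \<psi> z = - 1) \<and> (A * (A ^ i * L) \<le> \<phi> z \<longrightarrow> - \<eta> \<le> \<psi> z))"
    using b AL unfolding barrier_def by blast
  then obtain \<psi> where \<psi>: "\<And>i. psh X (\<psi> i)" and \<psi>z: "\<And>i z. z \<in> X \<Longrightarrow> - 1 \<le> \<psi> i z \<and> \<psi> i z \<le> 0 \<and>
     (\<phi> z \<le> 2 * (A ^ i * L) \<longrightarrow> \<psi> i z = - 1) \<and> (A * (A ^ i * L) \<le> \<phi> z \<longrightarrow> - \<eta> \<le> \<psi> i z)"
    by (auto dest!: choice)
  define \<Psi> where "\<Psi> = (\<lambda>z. 1 / m * (\<Sum>i<m. \<psi> i z))"
  have "psh X \<Psi>"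
    unfolding \<Psi>_def by (intro psh_cmult psh_sum \<psi> opX) auto
  moreover have "stairs A m L (\<phi> z) - \<eta> \<le> \<Psi> z \<and> \<Psi> z \<le> stairs A m L (\<phi> z) + 1 / m" if z: "z \<in> X" for z
  proof -
    \<comment> \<open>On \<open>K\<close> the summand is already at least \<open>- \<eta>\<close>;
      outside \<open>K'\<close> it is still - 1. As the scales are spaced by the factor
      \<open>A\<close>, \<open>K'\<close> consists at most of \<open>K\<close> shifted by one and
      the index 0. This one extra index is the error \<open>1 / m\<close>.\<close>
    define K where "K = {i. i < m \<and> A ^ Suc i * L \<le> \<phi> z}"
    define K' where "K' = {i. i < m \<and> A ^ i * L < \<phi> z}"
    have fin: "finite K" "finite K'" "K \<subseteq> {..<m}" "K' \<subseteq> {..<m}"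
      by (auto simp: K_def K'_def)
    have ind: "(\<Sum>i<m. (if i \<in> Q then 0 else - 1)) = real (card Q) - real m" if "Q \<subseteq> {..<m}" for Q
    proof -
      have "(\<Sum>i<m. (if i \<in> Q then 0 else - 1 :: real)) = (\<Sum>i<m. (if i \<in> Q then 1 else 0) - 1)"
        by (intro sum.cong) auto
      also have "\<dots> = real (card Q) - real m"
        using that by (simp add: sum_subtractf sum.If_cases Int_absorb1)
      finally show ?thesis .
    qed
    have "K' \<subseteq> insert 0 (Suc ` K)"
    proof
      fix i assume i: "i \<in> K'"
      show "i \<in> insert 0 (Suc ` K)"
        using i by (cases i) (auto simp: K_def K'_def)
    qed
    then have "card K' \<le> card (insert 0 (Suc ` K))"
      using fin by (intro card_mono) auto
    also have "\<dots> \<le> Suc (card (Suc ` K))"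
      by (rule card_insert_le_m1) auto
    also have "card (Suc ` K) = card K"
      by (intro card_image) auto
    finally have KK: "real (card K') \<le> real (card K) + 1"
      by simp
    have "(\<Sum>i<m. \<psi> i z) \<le> (\<Sum>i<m. (if i \<in> K' then 0 else - 1))"
    proof (rule sum_mono)
      fix i assume i: "i \<in> {..<m}"
      have "A ^ i * L \<ge> 0"
        using AL[of i] L by linarith
      then show "\<psi> i z \<le> (if i \<in> K' then 0 else - 1)"
        using \<psi>z[OF z, of i] i by (auto simp: K'_def)
    qed
    then have up: "(\<Sum>i<m. \<psi> i z) \<le> real (card K) + 1 - m"
      using KK unfolding ind[OF fin(4)] by linarith
    have "(\<Sum>i<m. (if i \<in> K then 0 else - 1) - \<eta>) \<le> (\<Sum>i<m. \<psi> i z)"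
    proof (rule sum_mono)
      fix i assume i: "i \<in> {..<m}"
      show "(if i \<in> K then 0 else - 1) - \<eta> \<le> \<psi> i z"
        using \<psi>z[OF z, of i] i \<eta> by (auto simp: K_def mult.assoc)
    qed
    then have low: "real (card K) - m - m * \<eta> \<le> (\<Sum>i<m. \<psi> i z)"
      unfolding sum_subtractf ind[OF fin(3)] by simp
    have st: "stairs A m L (\<phi> z) = real (card K) / m - 1"
      by (simp add: stairs_def K_def)
    have "(real (card K) - m - m * \<eta>) / m \<le> (\<Sum>i<m. \<psi> i z) / m"
      "(\<Sum>i<m. \<psi> i z) / m \<le> (real (card K) + 1 - m) / m"
      using low up by (intro divide_right_mono; simp)+
    with m show ?thesis
      unfolding st \<Psi>_def by (simp add: diff_divide_distrib add_divide_distrib)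
  qed
  ultimately show thesis
    using that by blast
qed

section \<open>Gluing over balls\<close>

text \<open>
  If the local functions agree up to \<open>2 \<eta>\<close>, a multiple of \<open>- |z - p|\<^sup>2\<close> makes each of them
  irrelevant for the maximum near the boundary of its ball. Adding the same multiple of \<open>|z|\<^sup>2\<close>
  to all of them turns these corrections into real affine functions.
\<close>

lemma psh_glue_balls:
  fixes F :: "complex^'n \<Rightarrow> real"
  assumes P: "finite P" and r: "r > 0" and \<eta>: "\<eta> > 0" and X0: "open X0" "X0 \<subseteq> X"
    and cover: "\<And>z. z \<in> X0 \<Longrightarrow> \<exists>p\<in>P. dist z p < r"
    and R: "\<And>z. z \<in> X0 \<Longrightarrow> norm z \<le> R"
    and \<Psi>: "\<And>p. p \<in> P \<Longrightarrow> psh (X \<inter> ball p (2 * r)) (\<Psi> p)"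
    and F: "\<And>p z. p \<in> P \<Longrightarrow> z \<in> X \<inter> ball p (2 * r) \<Longrightarrow> F z - \<eta> \<le> \<Psi> p z \<and> \<Psi> p z \<le> F z + \<eta>"
  obtains V where "psh X0 V"
    "\<And>z. z \<in> X0 \<Longrightarrow> F z - \<eta> * (9 + 2 * R\<^sup>2 / r\<^sup>2) \<le> V z \<and> V z \<le> F z + \<eta> * (9 + 2 * R\<^sup>2 / r\<^sup>2)"
proof -
  \<comment> \<open>For a centre within \<open>r\<close> and another beyond
    \<open>3 / 2 * r\<close>, the penalties differ by at least
    \<open>c * (5 / 4 * r\<^sup>2) = 5 / 2 * \<eta>\<close>, more than the possible disagreement
    \<open>2 * \<eta>\<close>. Within \<open>2 * r\<close> a penalty is at most
    \<open>8 * \<eta>\<close>, which with the error \<open>\<eta>\<close> of the local function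
    makes up the 9 in the bound.\<close>
  define c where "c = 2 * \<eta> / r\<^sup>2"
  have c: "c > 0" "c * r\<^sup>2 = 2 * \<eta>"
    using r \<eta> by (auto simp: c_def)
  define h where "h = (\<lambda>p z. \<Psi> p z + (- (c * (p \<bullet> p)) + z \<bullet> ((2 * c) *\<^sub>R p)))"
  have h: "h p z = \<Psi> p z + c * ((norm z)\<^sup>2 - (dist z p)\<^sup>2)" for p z
    by (simp add: h_def dist_norm power2_norm_eq_inner inner_commute algebra_simps)
  define V where "V = (\<lambda>z. Max ((\<lambda>p. h p z) ` {p \<in> P. dist z p < 2 * r}))"
  have mem: "z \<in> X \<inter> ball p (2 * r)" if "z \<in> X0" "dist z p < 2 * r" for z p
    using that X0 by (auto simp: dist_commute)
  have "psh X0 V"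
  proof (rule psh_local)
    fix z0 assume z0: "z0 \<in> X0"
    \<comment> \<open>\<open>7 / 4 * r\<close> is \<open>r / 4\<close> away from both
      \<open>2 * r\<close> and \<open>3 / 2 * r\<close>. So throughout \<open>N\<close> the centres
      in \<open>P0\<close> have their functions defined, and all others lose against a centre within
      \<open>r\<close>: locally the maximum runs over a fixed set.\<close>
    define P0 where "P0 = {p \<in> P. dist z0 p < 7 / 4 * r}"
    define N where "N = X0 \<inter> ball z0 (r / 4)"
    have near: "dist z p < dist z0 p + r / 4" "dist z0 p < dist z p + r / 4" if "z \<in> N" for z p
    proof -
      have "dist z z0 < r / 4"
        using that by (simp add: N_def dist_commute)
      with dist_triangle[of z p z0] dist_triangle[of z0 p z]
      show "dist z p < dist z0 p + r / 4" "dist z0 p < dist z p + r / 4"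
        unfolding dist_commute[of z0 z] by linarith+
    qed
    have P0: "finite P0" "P0 \<noteq> {}"
      using P cover[OF z0] r by (auto simp: P0_def intro: order_less_trans)
    have "psh N (\<lambda>z. Max ((\<lambda>p. h p z) ` P0))"
    proof (rule psh_Max[OF P0])
      fix p assume p: "p \<in> P0"
      have "N \<subseteq> X \<inter> ball p (2 * r)"
      proof
        fix z assume z: "z \<in> N"
        then show "z \<in> X \<inter> ball p (2 * r)"
          using near[OF z, of p] p by (intro mem) (auto simp: N_def P0_def)
      qed
      moreover have "open N"
        using X0 by (auto simp: N_def)
      ultimately show "psh N (h p)"
        unfolding h_def using p by (intro psh_add psh_affine psh_subset[OF \<Psi>]) (auto simp: P0_def)
    qed
    moreover have "V z = Max ((\<lambda>p. h p z) ` P0)" if z: "z \<in> N" for z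
    proof -
      have zX: "z \<in> X0"
        using z by (simp add: N_def)
      define P1 where "P1 = {p \<in> P. dist z p < 2 * r}"
      have sub: "P0 \<subseteq> P1" "finite P1"
      proof
        fix p assume "p \<in> P0"
        with near(1)[OF z, of p] show "p \<in> P1"
          by (simp add: P0_def P1_def)
      qed (use P in \<open>simp add: P1_def\<close>)
      obtain q where q: "q \<in> P" "dist z q < r"
        using cover[OF zX] by blast
      have qP0: "q \<in> P0"
        using q near[OF z, of q] by (simp add: P0_def)
      have "h p z \<le> Max ((\<lambda>p. h p z) ` P0)" if p: "p \<in> P1" for p
      proof (cases "p \<in> P0")
        case True
        then show ?thesis using P0 by (intro Max_ge) auto
      next
        case False
        then have far: "3 / 2 * r \<le> dist z p"
          using near[OF z, of p] p by (simp add: P0_def P1_def)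
        have "(3 / 2 * r)\<^sup>2 \<le> (dist z p)\<^sup>2" "(dist z q)\<^sup>2 \<le> r\<^sup>2"
          using far r q by (auto intro!: power_mono)
        then have "5 / 4 * r\<^sup>2 \<le> (dist z p)\<^sup>2 - (dist z q)\<^sup>2"
          by (simp add: power_mult_distrib power_divide)
        then have "c * (5 / 4 * r\<^sup>2) \<le> c * ((dist z p)\<^sup>2 - (dist z q)\<^sup>2)"
          using c by (intro mult_left_mono) auto
        then have "5 / 2 * \<eta> \<le> c * (dist z p)\<^sup>2 - c * (dist z q)\<^sup>2"
          using c(2) by (simp add: algebra_simps)
        moreover have "\<Psi> p z \<le> F z + \<eta>" "F z - \<eta> \<le> \<Psi> q z"
          using F[OF _ mem[OF zX]] p q r by (auto simp: P1_def)
        ultimately have "h p z \<le> h q z"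
          unfolding h right_diff_distrib using \<eta> by linarith
        also have "\<dots> \<le> Max ((\<lambda>p. h p z) ` P0)"
          using P0 qP0 by (intro Max_ge) auto
        finally show ?thesis .
      qed
      then have "Max ((\<lambda>p. h p z) ` P1) \<le> Max ((\<lambda>p. h p z) ` P0)"
        using P0 sub by (intro Max.boundedI) auto
      moreover have "Max ((\<lambda>p. h p z) ` P0) \<le> Max ((\<lambda>p. h p z) ` P1)"
        using P0 sub by (intro Max_mono) auto
      ultimately show ?thesis
        by (simp add: V_def P1_def)
    qed
    moreover have "z0 \<in> N" "N \<subseteq> X0"
      using z0 r by (auto simp: N_def)
    ultimately show "\<exists>N v. z0 \<in> N \<and> N \<subseteq> X0 \<and> psh N v \<and> (\<forall>x\<in>N. V x = v x)"
      by blast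
  qed
  moreover have "F z - \<eta> * (9 + 2 * R\<^sup>2 / r\<^sup>2) \<le> V z \<and> V z \<le> F z + \<eta> * (9 + 2 * R\<^sup>2 / r\<^sup>2)" if z: "z \<in> X0" for z
  proof -
    define P1 where "P1 = {p \<in> P. dist z p < 2 * r}"
    have P1: "finite P1" "P1 \<noteq> {}"
      using P cover[OF z] r by (auto simp: P1_def intro: order_less_trans)
    have "V z \<in> (\<lambda>p. h p z) ` P1"
      unfolding V_def P1_def[symmetric] using P1 by (intro Max_in) auto
    then obtain p where p: "p \<in> P" "dist z p < 2 * r" "V z = h p z"
      by (auto simp: P1_def)
    have "(norm z)\<^sup>2 \<le> R\<^sup>2" "(dist z p)\<^sup>2 \<le> (2 * r)\<^sup>2"
      using R[OF z] p(2) by (intro power_mono; simp)+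
    moreover have "(2 * r)\<^sup>2 = 4 * r\<^sup>2" "0 \<le> (norm z)\<^sup>2" "0 \<le> (dist z p)\<^sup>2"
      by (auto simp: power_mult_distrib)
    ultimately have "(norm z)\<^sup>2 - (dist z p)\<^sup>2 \<le> R\<^sup>2" "- (4 * r\<^sup>2) \<le> (norm z)\<^sup>2 - (dist z p)\<^sup>2"
      by linarith+
    then have "c * ((norm z)\<^sup>2 - (dist z p)\<^sup>2) \<le> c * R\<^sup>2" "c * (- (4 * r\<^sup>2)) \<le> c * ((norm z)\<^sup>2 - (dist z p)\<^sup>2)"
      using c(1) by (intro mult_left_mono; linarith)+
    moreover have "c * (- (4 * r\<^sup>2)) = - (8 * \<eta>)" "c * R\<^sup>2 = \<eta> * (2 * R\<^sup>2 / r\<^sup>2)"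
      using c(2) by (auto simp: algebra_simps c_def)
    moreover have "\<eta> * (2 * R\<^sup>2 / r\<^sup>2) \<ge> 0"
      using \<eta> by simp
    ultimately show ?thesis
      unfolding p(3) h using F[OF p(1) mem[OF z p(2)]] \<eta> unfolding distrib_left by linarith
  qed
  ultimately show thesis
    using that by blast
qed

section \<open>The global barrier\<close>

text \<open>Demanded only where \<phi> > L, since the gluing balls cover just a neighbourhood of the
  frontier. Up to 2 L only upper bounds are imposed: there the function is to lose in a maximum. The
  bound - 1/8 will provide the upper estimate of the final function, and - 1/2 the factor by which
  the weights may drop.\<close>

definition collar_barrier :: "(complex^'n) set \<Rightarrow> (complex^'n \<Rightarrow> real) \<Rightarrow> real \<Rightarrow> real \<Rightarrow> bool" where
  "collar_barrier \<Omega> \<phi> A L0 \<longleftrightarrow> (\<forall>L\<ge>L0. \<exists>V. psh {z \<in> \<Omega>. L < \<phi> z} V \<and>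
     (\<forall>z\<in>\<Omega>. L < \<phi> z \<longrightarrow> V z \<le> - 1 / 8 \<and> (\<phi> z \<le> 2 * L \<longrightarrow> V z \<le> - 1) \<and>
       (A * L \<le> \<phi> z \<longrightarrow> - 1 / 2 \<le> V z)))"

lemma global_barrier:
  fixes \<Omega> :: "(complex^'n) set"
  assumes op: "open \<Omega>" and bnd: "bounded \<Omega>" and ne: "frontier \<Omega> \<noteq> {}"
    and psh: "psh \<Omega> (log_dist \<Omega>)" and hoe: "Hoelder_boundary \<Omega>"
  obtains A L0 where "A \<ge> 2" "L0 > 0" "collar_barrier \<Omega> (log_dist \<Omega>) A L0"
proof -
  define \<phi> where "\<phi> = log_dist \<Omega>"
  have cont: "continuous_on \<Omega> \<phi>"
    unfolding \<phi>_def by (rule continuous_on_log_dist[OF op ne])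
  \<comment> \<open>All \<open>\<eta>\<close> are allowed for one and the same set: the radius of
    the gluing balls is fixed first, and \<open>\<eta>\<close> is then chosen in terms of it,
    because the gluing error is \<open>\<eta>\<close> times a constant depending on that
    radius.\<close>
  define good where "good = (\<lambda>Y. \<forall>\<eta>>0. \<exists>A L0. A \<ge> 2 \<and> L0 > 0 \<and> barrier Y \<phi> \<eta> A L0)"
  define G where "G = {ball p \<rho> | p \<rho>. good (\<Omega> \<inter> ball p \<rho>)}"
  have comp: "compact (frontier \<Omega>)"
    using bnd by (rule compact_frontier_bounded)
  have cov: "frontier \<Omega> \<subseteq> \<Union> G"
  proof
    fix p assume p: "p \<in> frontier \<Omega>"
    obtain \<rho> B C L0 where \<rho>: "\<rho> > 0" "B \<ge> 1" "C \<ge> 0"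
      "\<And>L. L \<ge> L0 \<Longrightarrow> \<exists>v. psh (\<Omega> \<inter> ball p \<rho>) v \<and> (\<forall>z\<in>\<Omega> \<inter> ball p \<rho>. v z \<le> B * L \<and>
        min (\<phi> z) L - C \<le> v z \<and> (\<phi> z \<le> L - C \<longrightarrow> v z \<le> \<phi> z + 1))"
      using Hoelder_boundary_chart[OF op ne psh hoe p] unfolding \<phi>_def by metis
    have opX: "open (\<Omega> \<inter> ball p \<rho>)"
      using op by auto
    obtain \<theta> L1 where \<theta>: "0 \<le> \<theta>" "\<theta> < 1" "L1 > 0" "barrier (\<Omega> \<inter> ball p \<rho>) \<phi> \<theta> 12 L1"
      using barrier_of_chart[OF \<rho>(2,3) opX \<rho>(4)] by metis
    have contX: "continuous_on (\<Omega> \<inter> ball p \<rho>) \<phi>"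
      using cont continuous_on_subset by blast
    have "good (\<Omega> \<inter> ball p \<rho>)"
      unfolding good_def
    proof (intro allI impI)
      fix \<eta> :: real assume "\<eta> > 0"
      then obtain A' where "A' \<ge> 2" "barrier (\<Omega> \<inter> ball p \<rho>) \<phi> \<eta> A' L1"
        using barrier_arbitrarily_good[OF contX opX \<theta>(4) _ \<theta>(1-3)] by auto
      with \<theta>(3) show "\<exists>A L0. A \<ge> 2 \<and> L0 > 0 \<and> barrier (\<Omega> \<inter> ball p \<rho>) \<phi> \<eta> A L0"
        by blast
    qed
    then show "p \<in> \<Union> G"
      using \<rho>(1) unfolding G_def by (intro UnionI[of "ball p \<rho>"]) auto
  qed
  have opG: "open U" if "U \<in> G" for U
    using that by (auto simp: G_def)
  obtain \<epsilon> where \<epsilon>: "\<epsilon> > 0" "\<And>x. x \<in> frontier \<Omega> \<Longrightarrow> \<exists>U\<in>G. ball x \<epsilon> \<subseteq> U"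
    using Heine_Borel_lemma[OF comp cov] opG by metis
  define r where "r = \<epsilon> / 2"
  have r: "r > 0"
    using \<epsilon> by (simp add: r_def)
  have good_r: "good (\<Omega> \<inter> ball p (2 * r))" if p: "p \<in> frontier \<Omega>" for p
  proof -
    obtain q \<rho> where "good (\<Omega> \<inter> ball q \<rho>)" "ball p \<epsilon> \<subseteq> ball q \<rho>"
      using \<epsilon>(2)[OF p] unfolding G_def by blast
    note q = this
    show ?thesis
      unfolding good_def
    proof (intro allI impI)
      fix \<eta> :: real assume "\<eta> > 0"
      then obtain A L0 where "A \<ge> 2" "L0 > 0" "barrier (\<Omega> \<inter> ball q \<rho>) \<phi> \<eta> A L0"
        using q(1) unfolding good_def by blast
      moreover from this(3) have "barrier (\<Omega> \<inter> ball p (2 * r)) \<phi> \<eta> A L0"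
        by (rule barrier_subset) (use q(2) op in \<open>auto simp: r_def\<close>)
      ultimately show "\<exists>A L0. A \<ge> 2 \<and> L0 > 0 \<and> barrier (\<Omega> \<inter> ball p (2 * r)) \<phi> \<eta> A L0"
        by blast
    qed
  qed
  obtain P where P: "P \<subseteq> frontier \<Omega>" "finite P" "frontier \<Omega> \<subseteq> (\<Union>p\<in>P. ball p (r / 2))"
    using compactE_image[OF comp, of "frontier \<Omega>" "\<lambda>p. ball p (r / 2)"] r
    by (metis UN_I centre_in_ball half_gt_zero open_ball subsetI)
  obtain R where R: "\<And>z. z \<in> \<Omega> \<Longrightarrow> norm z \<le> R"
    using bnd unfolding bounded_iff by blast
  define Q where "Q = 9 + 2 * R\<^sup>2 / r\<^sup>2"
  \<comment> \<open>The gluing error around \<open>stairs\<close> is then 1/8. After a shift by -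
    1/4 the values are at most - 1/8 everywhere, at most - 9/8 on the lowest step and at least - 3/8
    on the highest.\<close>
  define \<eta> where "\<eta> = 1 / (8 * Q)"
  have Q: "Q > 0"
    unfolding Q_def by (intro add_pos_nonneg) auto
  then have \<eta>: "\<eta> > 0" "\<eta> * Q = 1 / 8"
    by (auto simp: \<eta>_def)
  have "\<forall>p\<in>P. \<exists>A L0. A \<ge> 2 \<and> L0 > 0 \<and> barrier (\<Omega> \<inter> ball p (2 * r)) \<phi> \<eta> A L0"
    using good_r P(1) \<eta>(1) unfolding good_def by blast
  then obtain Ap Lp where AL: "\<And>p. p \<in> P \<Longrightarrow> Ap p \<ge> 2 \<and> Lp p > 0 \<and> barrier (\<Omega> \<inter> ball p (2 * r)) \<phi> \<eta> (Ap p) (Lp p)"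
    by metis
  define A :: real where "A = 3 + sum Ap P"
  define L1 :: real where "L1 = 1 + sum Lp P"
  \<comment> \<open>\<phi> > - ln (r / 2) means a distance below \<open>r / 2\<close> from the
    frontier, whose points lie within \<open>r / 2\<close> of \<open>P\<close>; together this gives
    a centre within \<open>r\<close>.\<close>
  define L0 where "L0 = max L1 (- ln (r / 2))"
  have Apos: "0 \<le> Ap p" "0 \<le> Lp p" if "p \<in> P" for p
    using AL[OF that] by auto
  have A: "A > 2" and L1: "L1 > 0"
    using Apos by (auto simp: A_def L1_def intro!: add_pos_nonneg add_less_le_mono[of 2 3 0, simplified] sum_nonneg)
  have bar: "barrier (\<Omega> \<inter> ball p (2 * r)) \<phi> \<eta> A L1" if p: "p \<in> P" for p
  proof (rule barrier_mono)
    show "barrier (\<Omega> \<inter> ball p (2 * r)) \<phi> \<eta> (Ap p) (Lp p)" "0 \<le> Lp p"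
      using AL[OF p] by auto
    show "Ap p \<le> A" "Lp p \<le> L1"
      unfolding A_def L1_def
      using member_le_sum[OF p, of Ap] member_le_sum[OF p, of Lp] Apos P(2) by auto
  qed simp
  obtain m0 :: nat where "1 / \<eta> < m0"
    using reals_Archimedean2 by blast
  define m where "m = Suc m0"
  have m: "m > 0" "1 / m \<le> \<eta>"
  proof -
    have "1 / \<eta> < m"
      using \<open>1 / \<eta> < m0\<close> by (simp add: m_def)
    then show "1 / m \<le> \<eta>"
      using \<eta>(1) by (simp add: m_def field_simps)
  qed (simp add: m_def)
  have Am: "A ^ m \<ge> 2"
  proof -
    have "A ^ 1 \<le> A ^ m"
      using A m by (intro power_increasing) auto
    with A show ?thesis by simp
  qed
  have "\<exists>V. psh {z \<in> \<Omega>. L < \<phi> z} V \<and>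
       (\<forall>z\<in>\<Omega>. L < \<phi> z \<longrightarrow> V z \<le> - 1 / 8 \<and> (\<phi> z \<le> 2 * L \<longrightarrow> V z \<le> - 1) \<and>
         (A ^ m * L \<le> \<phi> z \<longrightarrow> - 1 / 2 \<le> V z))" if L: "L \<ge> L0" for L
  proof -
    have LL: "L1 \<le> L" "L > 0" "- ln (r / 2) \<le> L"
      using L L1 by (auto simp: L0_def)
    define S where "S = (\<lambda>z. stairs A m L (\<phi> z))"
    have "\<exists>\<Psi>. psh (\<Omega> \<inter> ball p (2 * r)) \<Psi> \<and> (\<forall>z\<in>\<Omega> \<inter> ball p (2 * r). S z - \<eta> \<le> \<Psi> z \<and> \<Psi> z \<le> S z + \<eta>)"
      if p: "p \<in> P" for p
    proof -
      obtain \<Psi> where "psh (\<Omega> \<inter> ball p (2 * r)) \<Psi>"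
        "\<And>z. z \<in> \<Omega> \<inter> ball p (2 * r) \<Longrightarrow> stairs A m L (\<phi> z) - \<eta> \<le> \<Psi> z \<and> \<Psi> z \<le> stairs A m L (\<phi> z) + 1 / m"
        using barrier_stairs[OF _ bar[OF p] A m(1) LL(1) L1] op \<eta>(1) by (metis less_imp_le open_Int open_ball)
      with m(2) show ?thesis
        unfolding S_def by (intro exI[of _ \<Psi>]) force
    qed
    then obtain \<Psi> where \<Psi>: "\<And>p. p \<in> P \<Longrightarrow> psh (\<Omega> \<inter> ball p (2 * r)) (\<Psi> p)"
      "\<And>p z. p \<in> P \<Longrightarrow> z \<in> \<Omega> \<inter> ball p (2 * r) \<Longrightarrow> S z - \<eta> \<le> \<Psi> p z \<and> \<Psi> p z \<le> S z + \<eta>"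
      by metis
    define X0 where "X0 = {z \<in> \<Omega>. L < \<phi> z}"
    have "X0 = \<Omega> \<inter> \<phi> -` {L<..}"
      by (auto simp: X0_def)
    then have X0: "open X0" "X0 \<subseteq> \<Omega>"
      using continuous_open_preimage[OF cont op open_greaterThan[of L]] by auto
    have cover: "\<exists>p\<in>P. dist z p < r" if z: "z \<in> X0" for z
    proof -
      have z\<Omega>: "z \<in> \<Omega>" and "exp (- \<phi> z) < exp (ln (r / 2))"
        using z LL(3) by (auto simp: X0_def)
      then have "infdist z (frontier \<Omega>) < r / 2"
        using exp_log_dist[OF op ne z\<Omega>] r by (simp add: \<phi>_def)
      moreover obtain q where q: "q \<in> frontier \<Omega>" "infdist z (frontier \<Omega>) = dist z q"
        using infdist_attains_inf[OF frontier_closed ne] by metis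
      moreover obtain p where "p \<in> P" "q \<in> ball p (r / 2)"
        using P(3) q(1) by auto
      ultimately show ?thesis
        using dist_triangle[of z p q] by (intro bexI[of _ p]) (auto simp: dist_commute)
    qed
    obtain V where V: "psh X0 V" "\<And>z. z \<in> X0 \<Longrightarrow> S z - \<eta> * Q \<le> V z \<and> V z \<le> S z + \<eta> * Q"
      unfolding Q_def
      using psh_glue_balls[OF P(2) r \<eta>(1) X0 cover R[OF subsetD[OF X0(2)]] \<Psi>] by metis
    have "psh X0 (\<lambda>z. V z + (- 1 / 4))"
      by (intro psh_add V psh_const X0)
    moreover have "V z + (- 1 / 4) \<le> - 1 / 8 \<and> (\<phi> z \<le> 2 * L \<longrightarrow> V z + (- 1 / 4) \<le> - 1) \<and>
         (A ^ m * L \<le> \<phi> z \<longrightarrow> - 1 / 2 \<le> V z + (- 1 / 4))" if z: "z \<in> X0" for z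
      using V(2)[OF z] stairs_le_0[of A m L "\<phi> z"] stairs_low[OF A LL(2), of "\<phi> z" m]
        stairs_high[OF A LL(2) m(1), of "\<phi> z"]
      unfolding \<eta>(2) S_def by auto
    ultimately show ?thesis
      unfolding X0_def by (intro exI[of _ "\<lambda>z. V z + (- 1 / 4)"]) blast
  qed
  then have "collar_barrier \<Omega> (log_dist \<Omega>) (A ^ m) L0"
    unfolding collar_barrier_def \<phi>_def by blast
  moreover have "L0 > 0"
    using L1 by (simp add: L0_def)
  ultimately show thesis
    using that[OF Am] by blast
qed

section \<open>Iteration over all scales\<close>

lemma ex_scale:
  assumes "A \<ge> 2" "L0 > (0::real)"
  obtains k :: nat where "x < A ^ k * L0"
proof -
  obtain k where "x / L0 < A ^ k"
    using real_arch_pow[of A] assms(1) by auto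
  with assms(2) show thesis
    by (intro that[of k]) (simp add: field_simps)
qed

lemma ex_scale_interval:
  assumes "A \<ge> 2" "L0 > (0::real)" "L0 \<le> x"
  obtains k :: nat where "A ^ k * L0 \<le> x" "x \<le> A ^ Suc k * L0"
proof -
  define n where "n = (LEAST k. x < A ^ k * L0)"
  have ex: "\<exists>k. x < A ^ k * L0"
    using ex_scale[OF assms(1,2)] by blast
  have n: "x < A ^ n * L0"
    unfolding n_def using ex by (rule LeastI_ex)
  then have "n \<noteq> 0"
    using assms(3) by (intro notI) simp
  then obtain k where k: "n = Suc k"
    using not0_implies_Suc by blast
  then have "\<not> x < A ^ k * L0"
    unfolding n_def using not_less_Least[of k "\<lambda>k. x < A ^ k * L0"] by simp
  with n k show thesis
    by (intro that[of k]) auto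
qed

text \<open>The induction keeps \<open>w k\<close> at least \<open>- M k\<close> where
  \<open>\<phi> z \<ge> \<Lambda> k\<close>. So \<open>M k * v k\<close>, which is at most
  \<open>- M k\<close> up to \<open>2 * \<Lambda> k\<close>, can be glued in. From
  \<open>\<Lambda> (Suc k)\<close> on it is at least \<open>- M k / 2\<close>, hence at least
  \<open>- M (Suc k)\<close> by the last assumption on \<open>M\<close>, and the induction closes.
  Monotonicity of \<open>M\<close> carries the upper bound along.\<close>

lemma psh_scale_iteration:
  fixes \<phi> :: "complex^'n \<Rightarrow> real" and M :: "nat \<Rightarrow> real"
  assumes op: "open \<Omega>" and cont: "continuous_on \<Omega> \<phi>" and A: "A \<ge> 2" and L0: "L0 > 0"
    and V: "collar_barrier \<Omega> \<phi> A L0"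
    and M: "\<And>k. M k > 0" "\<And>k. M (Suc k) \<le> M k" "\<And>k. M k \<le> 2 * M (Suc k)"
  obtains W where "psh \<Omega> W" "\<forall>z\<in>\<Omega>. \<phi> z \<le> L0 \<longrightarrow> W z = - M 0"
    "\<forall>k. \<forall>z\<in>\<Omega>. A ^ k * L0 \<le> \<phi> z \<longrightarrow> \<phi> z \<le> A ^ Suc k * L0 \<longrightarrow> - M k \<le> W z \<and> W z \<le> - M k / 8"
proof -
  define \<Lambda> where "\<Lambda> = (\<lambda>k. A ^ k * L0)"
  have \<Lambda>_mono: "\<Lambda> j \<le> \<Lambda> k" if "j \<le> k" for j k
    using A L0 that by (auto simp: \<Lambda>_def intro!: mult_right_mono power_increasing)
  have \<Lambda>0: "\<Lambda> 0 = L0"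
    by (simp add: \<Lambda>_def)
  have \<Lambda>: "\<Lambda> k \<ge> L0" "\<Lambda> k > 0" "2 * \<Lambda> k \<le> \<Lambda> (Suc k)" "\<Lambda> (Suc k) = A * \<Lambda> k" for k
  proof -
    show "\<Lambda> k \<ge> L0"
      using \<Lambda>_mono[of 0 k] \<Lambda>0 by simp
    then show 0: "\<Lambda> k > 0"
      using L0 by simp
    show *: "\<Lambda> (Suc k) = A * \<Lambda> k"
      by (simp add: \<Lambda>_def)
    show "2 * \<Lambda> k \<le> \<Lambda> (Suc k)"
      unfolding * using A 0 by (intro mult_right_mono) auto
  qed
  have "\<forall>k. \<exists>V. psh {z \<in> \<Omega>. \<Lambda> k < \<phi> z} V \<and>
       (\<forall>z\<in>\<Omega>. \<Lambda> k < \<phi> z \<longrightarrow> V z \<le> - 1 / 8 \<and> (\<phi> z \<le> 2 * \<Lambda> k \<longrightarrow> V z \<le> - 1) \<and>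
         (\<Lambda> (Suc k) \<le> \<phi> z \<longrightarrow> - 1 / 2 \<le> V z))"
    using V \<Lambda>(1) unfolding \<Lambda>(4) collar_barrier_def by blast
  from choice[OF this] obtain v where v: "\<And>k. psh {z \<in> \<Omega>. \<Lambda> k < \<phi> z} (v k)"
    "\<And>k z. z \<in> \<Omega> \<Longrightarrow> \<Lambda> k < \<phi> z \<Longrightarrow> v k z \<le> - 1 / 8 \<and> (\<phi> z \<le> 2 * \<Lambda> k \<longrightarrow> v k z \<le> - 1) \<and>
         (\<Lambda> (Suc k) \<le> \<phi> z \<longrightarrow> - 1 / 2 \<le> v k z)"
    by blast
  define w where "w = rec_nat (\<lambda>_. - M 0) (\<lambda>k u z. if \<phi> z \<le> \<Lambda> k then u z else max (u z) (M k * v k z))"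
  have w0: "w 0 z = - M 0" and wS: "w (Suc k) z = (if \<phi> z \<le> \<Lambda> k then w k z else max (w k z) (M k * v k z))" for k z
    by (simp_all add: w_def)
  have Mv: "M k * v k z \<le> - M k / 8" if "z \<in> \<Omega>" "\<Lambda> k < \<phi> z" for k z
    using mult_left_mono[of "v k z" "- 1 / 8" "M k"] v(2)[OF that] M(1)[of k] by simp
  have w: "psh \<Omega> (w k) \<and> (\<forall>z\<in>\<Omega>. w k z \<le> - M k / 8 \<and> (\<Lambda> k \<le> \<phi> z \<longrightarrow> - M k \<le> w k z))" for k
  proof (induction k)
    case 0
    have "psh \<Omega> (w 0)"
      by (rule psh_cong[OF psh_const[OF op]]) (rule w0)
    moreover have "w 0 z \<le> - M 0 / 8 \<and> - M 0 \<le> w 0 z" for z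
      using M(1)[of 0] by (simp add: w0)
    ultimately show ?case by blast
  next
    case (Suc k)
    have "psh \<Omega> (\<lambda>z. if \<phi> z \<le> \<Lambda> k then w k z else max (w k z) (M k * v k z))"
    proof (rule psh_glue_above[OF cont _ _ \<Lambda>(2)])
      show "psh {z \<in> \<Omega>. \<Lambda> k < \<phi> z} (\<lambda>z. M k * v k z)"
        using M(1)[of k] by (intro psh_cmult v) auto
      show "M k * v k z \<le> w k z" if "z \<in> \<Omega>" "\<Lambda> k < \<phi> z" "\<phi> z \<le> 2 * \<Lambda> k" for z
      proof -
        have "M k * v k z \<le> M k * (- 1)"
          using v(2)[OF that(1,2)] that(3) M(1)[of k] by (intro mult_left_mono) auto
        also have "\<dots> \<le> w k z"
          using Suc that by auto
        finally show ?thesis .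
      qed
    qed (use Suc in blast)
    then have "psh \<Omega> (w (Suc k))"
      by (rule psh_cong) (rule wS)
    moreover have "w (Suc k) z \<le> - M (Suc k) / 8" if z: "z \<in> \<Omega>" for z
    proof -
      have "w (Suc k) z \<le> - M k / 8"
        using Suc z Mv[OF z] by (auto simp: wS)
      with M(2)[of k] show ?thesis by simp
    qed
    moreover have "- M (Suc k) \<le> w (Suc k) z" if z: "z \<in> \<Omega>" "\<Lambda> (Suc k) \<le> \<phi> z" for z
    proof -
      have *: "\<Lambda> k < \<phi> z"
        using z(2) \<Lambda>(2,3)[of k] by linarith
      have "- M (Suc k) \<le> M k * (- 1 / 2)"
        using M(3)[of k] by simp
      also have "\<dots> \<le> M k * v k z"
        using v(2)[OF z(1) *] z(2) M(1)[of k] by (intro mult_left_mono) auto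
      also have "\<dots> \<le> w (Suc k) z"
        using * by (simp add: wS)
      finally show ?thesis .
    qed
    ultimately show ?case by blast
  qed
  have stable: "w j z = w k z" if "\<phi> z \<le> \<Lambda> k" "k \<le> j" for j k z
    using that(2)
  proof (induction j rule: dec_induct)
    case (step j)
    then have "\<phi> z \<le> \<Lambda> j"
      using that(1) \<Lambda>_mono[of k j] by simp
    with step show ?case by (simp add: wS)
  qed simp
  \<comment> \<open>By \<open>stable\<close> any larger index may replace the least one, so on each
    open set where \<phi> < \<Lambda> k the limit is a single \<open>w k\<close>.\<close>
  define W where "W = (\<lambda>z. w (LEAST k. \<phi> z \<le> \<Lambda> k) z)"
  have W: "W z = w k z" if "\<phi> z \<le> \<Lambda> k" for k z
    unfolding W_def using that
    by (intro stable[symmetric] LeastI[of "\<lambda>k. \<phi> z \<le> \<Lambda> k" k] Least_le)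
  show thesis
  proof (rule that)
    show "psh \<Omega> W"
    proof (rule psh_local)
      fix z assume z: "z \<in> \<Omega>"
      obtain k where k: "\<phi> z < \<Lambda> k"
        using ex_scale[OF A L0] unfolding \<Lambda>_def by blast
      have "\<Omega> \<inter> \<phi> -` {..<\<Lambda> k} = {x \<in> \<Omega>. \<phi> x < \<Lambda> k}"
        by auto
      then have "open {x \<in> \<Omega>. \<phi> x < \<Lambda> k}"
        using continuous_open_preimage[OF cont op open_lessThan[of "\<Lambda> k"]] by simp
      then have "psh {x \<in> \<Omega>. \<phi> x < \<Lambda> k} (w k)"
        by (intro psh_subset[OF conjunct1[OF w[of k]]]) auto
      with z k W show "\<exists>N u. z \<in> N \<and> N \<subseteq> \<Omega> \<and> psh N u \<and> (\<forall>x\<in>N. W x = u x)"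
        by (intro exI[of _ "{x \<in> \<Omega>. \<phi> x < \<Lambda> k}"] exI[of _ "w k"]) auto
    qed
    show "\<forall>z\<in>\<Omega>. \<phi> z \<le> L0 \<longrightarrow> W z = - M 0"
      using W[of _ 0] by (simp add: \<Lambda>0 w0)
  next
    show "\<forall>k. \<forall>z\<in>\<Omega>. A ^ k * L0 \<le> \<phi> z \<longrightarrow> \<phi> z \<le> A ^ Suc k * L0 \<longrightarrow> - M k \<le> W z \<and> W z \<le> - M k / 8"
    proof (intro allI ballI impI)
      fix k z assume z: "z \<in> \<Omega>" "A ^ k * L0 \<le> \<phi> z" "\<phi> z \<le> A ^ Suc k * L0"
      \<comment> \<open>The index is \<open>Suc k\<close> because the summand of weight
        \<open>M k\<close> enters at this stage of the recursion.\<close>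
      then have "W z = w (Suc k) z"
        by (intro W) (simp add: \<Lambda>_def)
      moreover have "- M k \<le> w (Suc k) z"
        using w[of k] z by (auto simp: wS \<Lambda>_def max.coboundedI1)
      moreover have "w (Suc k) z \<le> - M k / 8"
        using w[of k] z(1) Mv[OF z(1)] by (auto simp: wS)
      ultimately show "- M k \<le> W z \<and> W z \<le> - M k / 8"
        by simp
    qed
  qed
qed

section \<open>The weights and the final estimate\<close>

definition decay :: "real \<Rightarrow> real \<Rightarrow> real" where
  "decay \<tau> x = 1 / (x powr \<tau> * ln x)"

lemma decay_pos: "x > 1 \<Longrightarrow> decay \<tau> x > 0"
  by (simp add: decay_def)

lemma decay_antimono:
  assumes "1 < x" "x \<le> y" "\<tau> > 0"
  shows "decay \<tau> y \<le> decay \<tau> x"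
  unfolding decay_def using assms
  by (intro divide_left_mono mult_mono powr_mono2 mult_pos_pos) auto

text \<open>The exponent gives \<open>A powr \<tau> = 4 / 3\<close>, and
  \<open>x \<ge> A\<^sup>2\<close> gives ln A \<le> ln x / 2, so the logarithm grows by at most the
  factor 3/2; the product of the two factors is 2.\<close>

lemma decay_scale:
  assumes "A \<ge> 2" "x \<ge> A\<^sup>2"
  shows "decay (ln (4 / 3) / ln A) x \<le> 2 * decay (ln (4 / 3) / ln A) (A * x)"
proof -
  define \<tau> where "\<tau> = ln (4 / 3) / ln A"
  have "A * 1 \<le> A * A"
    using assms by (intro mult_left_mono) auto
  then have x: "x \<ge> 2"
    using assms unfolding power2_eq_square by linarith
  have "A powr \<tau> = 4 / 3"
    using assms by (simp add: powr_def \<tau>_def)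
  then have 1: "(A * x) powr \<tau> = 4 / 3 * x powr \<tau>"
    using assms x by (simp add: powr_mult)
  have "ln (A\<^sup>2) \<le> ln x"
    using assms by (subst ln_le_cancel_iff) (auto intro: order_less_le_trans[of 0 "A\<^sup>2"])
  then have 2: "2 * ln A \<le> ln x"
    using assms by (simp add: ln_realpow)
  have 3: "ln (A * x) = ln A + ln x"
    using assms x by (simp add: ln_mult)
  have pos: "x powr \<tau> > 0" "ln x > 0" "ln A > 0"
    using x assms by auto
  have "x powr \<tau> * (4 / 3 * (ln A + ln x)) \<le> x powr \<tau> * (2 * ln x)"
    using pos 2 by (intro mult_left_mono) auto
  then have "1 / (x powr \<tau> * (2 * ln x)) \<le> 1 / (x powr \<tau> * (4 / 3 * (ln A + ln x)))"
    using pos by (intro divide_left_mono mult_pos_pos) auto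
  then show ?thesis
    unfolding \<tau>_def[symmetric] decay_def 1 3 by (simp add: field_simps)
qed

text \<open>The factor log (- log d) vanishes at d = exp (- 1) and is negative for d between exp (-
  1) and 1, so the estimate is stated for \<open>d z \<le> \<delta>\<close> with an arbitrary
  \<open>\<delta> < exp (- 1)\<close>. The exponent and the function are chosen before
  \<open>\<delta>\<close>; only \<open>M1\<close> and \<open>M2\<close> may depend on it.\<close>

theorem theorem1:
  fixes \<Omega> :: "(complex^'n) set" and d :: "complex^'n \<Rightarrow> real"
  assumes "open \<Omega>" and "connected \<Omega>" and "\<Omega> \<noteq> {}"
    and "bounded \<Omega>"
    and "pseudoconvex \<Omega>"
    and "Hoelder_boundary \<Omega>"
  defines "d \<equiv> \<lambda>z. infdist z (frontier \<Omega>)"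
  shows "\<exists>\<tau>>0. \<exists>w. continuous_on \<Omega> w \<and> plurisubharmonic_on \<Omega> w \<and>
           (\<forall>\<delta>. 0 < \<delta> \<and> \<delta> < exp (- 1) \<longrightarrow>
              (\<exists>M1>0. \<exists>M2>0. \<forall>z\<in>\<Omega>. d z \<le> \<delta> \<longrightarrow>
                 - (M1 / (- ln (d z)) powr \<tau>) * (1 / ln (- ln (d z))) \<le> w z \<and>
                 w z \<le> - (M2 / (- ln (d z)) powr \<tau>) * (1 / ln (- ln (d z)))))"
proof -
  have ne: "frontier \<Omega> \<noteq> {}"
    using assms(3,4) frontier_eq_empty not_bounded_UNIV by blast
  obtain u where u: "continuous_on \<Omega> u" "plurisubharmonic_on \<Omega> u" "\<And>c. compact {z \<in> \<Omega>. u z \<le> c}"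
    using assms(5) unfolding pseudoconvex_def by blast
  have psh: "psh \<Omega> (log_dist \<Omega>)"
    by (rule psh_log_dist[OF ne plurisubharmonic_on_imp_psh[OF assms(1) u(1,2)] u(3)])
  define \<phi> where "\<phi> = log_dist \<Omega>"
  have cont: "continuous_on \<Omega> \<phi>"
    using psh psh_continuous unfolding \<phi>_def by blast
  obtain A L1 where A: "A \<ge> 2" "L1 > 0"
    and V: "collar_barrier \<Omega> \<phi> A L1"
    by (rule global_barrier[OF assms(1,4) ne psh assms(6), folded \<phi>_def]) (rule that; assumption)
  \<comment> \<open>The bound \<open>A\<^sup>2\<close> makes \<open>decay_scale\<close> applicable
    at every scale and puts all scales above 1, where \<open>decay\<close> is positive and
    decreasing.\<close>
  define L0 where "L0 = max L1 (A\<^sup>2)"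
  define \<tau> where "\<tau> = ln (4 / 3) / ln A"
  have \<tau>: "\<tau> > 0"
    using A by (simp add: \<tau>_def)
  have A2: "1 < A\<^sup>2"
    using A by (simp add: one_less_power)
  have L0: "L0 > 0" "L0 > 1" "L0 \<ge> L1" "L0 \<ge> A\<^sup>2"
    unfolding L0_def using A(2) order_less_le_trans[OF A2 max.cobounded2] by auto
  have scale: "L0 \<le> A ^ k * L0" for k
  proof -
    have "1 * L0 \<le> A ^ k * L0"
      using A L0 by (intro mult_right_mono one_le_power) auto
    then show ?thesis by simp
  qed
  define M where "M = (\<lambda>k. decay \<tau> (A ^ k * L0))"
  have M: "M k > 0" "M (Suc k) \<le> M k" "M k \<le> 2 * M (Suc k)" for k
  proof -
    have g: "1 < A ^ k * L0" "A\<^sup>2 \<le> A ^ k * L0"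
      using scale[of k] L0 by linarith+
    show "M k > 0"
      unfolding M_def using g by (intro decay_pos)
    have "A ^ k * L0 \<le> A ^ Suc k * L0"
      using A L0 by (intro mult_right_mono power_increasing) auto
    with g show "M (Suc k) \<le> M k"
      unfolding M_def using \<tau> by (intro decay_antimono)
    show "M k \<le> 2 * M (Suc k)"
      using decay_scale[OF A(1) g(2)] unfolding M_def \<tau>_def by (simp add: mult.assoc)
  qed
  have V0: "collar_barrier \<Omega> \<phi> A L0"
    using V L0(3) unfolding collar_barrier_def by (meson order_trans)
  obtain W where W: "psh \<Omega> W" "\<forall>z\<in>\<Omega>. \<phi> z \<le> L0 \<longrightarrow> W z = - M 0"
    "\<forall>k. \<forall>z\<in>\<Omega>. A ^ k * L0 \<le> \<phi> z \<longrightarrow> \<phi> z \<le> A ^ Suc k * L0 \<longrightarrow> - M k \<le> W z \<and> W z \<le> - M k / 8"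
    by (rule psh_scale_iteration[where M = M, OF assms(1) cont A(1) L0(1) V0 M]) (rule that; assumption)
  have "\<exists>M1>0. \<exists>M2>0. \<forall>z\<in>\<Omega>. d z \<le> \<delta> \<longrightarrow>
                 - (M1 / (- ln (d z)) powr \<tau>) * (1 / ln (- ln (d z))) \<le> W z \<and>
                 W z \<le> - (M2 / (- ln (d z)) powr \<tau>) * (1 / ln (- ln (d z)))"
    if \<delta>: "0 < \<delta>" "\<delta> < exp (- 1)" for \<delta>
  proof -
    define a where "a = - ln \<delta>"
    have a: "a > 1"
      using \<delta> ln_less_cancel_iff[of \<delta> "exp (- 1)"] by (simp add: a_def)
    \<comment> \<open>For \<phi> between \<open>a\<close> and \<open>L0\<close> the function is the
      constant \<open>- decay \<tau> L0\<close>, while \<open>decay \<tau> (\<phi> z)\<close> can be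
      as large as \<open>decay \<tau> a\<close>: hence the quotient. The value 1/8 is dictated by
      the scales above \<open>L0\<close>.\<close>
    define M2 where "M2 = min (1 / 8) (decay \<tau> L0 / decay \<tau> a)"
    have M2: "M2 > 0" "M2 \<le> 1 / 8" "M2 * decay \<tau> a \<le> decay \<tau> L0"
    proof -
      show "M2 > 0"
        using decay_pos[OF a, of \<tau>] decay_pos[OF L0(2), of \<tau>] by (simp add: M2_def)
      have "M2 * decay \<tau> a \<le> decay \<tau> L0 / decay \<tau> a * decay \<tau> a"
        using decay_pos[OF a, of \<tau>] by (intro mult_right_mono) (auto simp: M2_def)
      then show "M2 * decay \<tau> a \<le> decay \<tau> L0"
        using decay_pos[OF a, of \<tau>] by simp
      show "M2 \<le> 1 / 8"
        unfolding M2_def by (rule min.cobounded1)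
    qed
    have "- (2 * decay \<tau> (\<phi> z)) \<le> W z \<and> W z \<le> - (M2 * decay \<tau> (\<phi> z))" if z: "z \<in> \<Omega>" "d z \<le> \<delta>" for z
    proof -
      have "d z > 0"
        unfolding d_def by (rule infdist_frontier_pos[OF assms(1) ne z(1)])
      then have \<phi>a: "a \<le> \<phi> z"
        using z(2) by (simp add: a_def \<phi>_def log_dist_def d_def)
      then have dec: "decay \<tau> (\<phi> z) \<le> decay \<tau> a" "decay \<tau> (\<phi> z) > 0"
        using a \<tau> by (auto intro!: decay_antimono decay_pos)
      show ?thesis
      proof (cases "\<phi> z \<le> L0")
        case True
        then have w: "W z = - decay \<tau> L0"
          using W(2) z(1) by (simp add: M_def)
        have "decay \<tau> L0 \<le> decay \<tau> (\<phi> z)"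
          using True a \<phi>a \<tau> by (intro decay_antimono) auto
        moreover have "M2 * decay \<tau> (\<phi> z) \<le> M2 * decay \<tau> a"
          using M2 dec by (intro mult_left_mono) auto
        ultimately show ?thesis
          unfolding w using M2 dec by linarith
      next
        case False
        then obtain k where k: "A ^ k * L0 \<le> \<phi> z" "\<phi> z \<le> A ^ Suc k * L0"
          using ex_scale_interval[OF A(1) L0(1), of "\<phi> z"] by force
        \<comment> \<open>\<open>M (Suc k)\<close> and \<open>M k\<close> enclose
          \<open>decay \<tau> (\<phi> z)\<close> and differ by a factor of at most 2, which is the
          origin of the witness 2 for \<open>M1\<close>.\<close>
        have "M (Suc k) \<le> decay \<tau> (\<phi> z)"
          unfolding M_def using k a \<phi>a \<tau> by (intro decay_antimono) auto
        moreover have "1 < A ^ k * L0"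
          using scale[of k] L0(2) by linarith
        then have "decay \<tau> (\<phi> z) \<le> M k"
          unfolding M_def using k(1) \<tau> by (intro decay_antimono)
        moreover have "M2 * decay \<tau> (\<phi> z) \<le> 1 / 8 * decay \<tau> (\<phi> z)"
          using M2 dec by (intro mult_right_mono) auto
        ultimately show ?thesis
          using W(3)[rule_format, OF z(1) k] M(3)[of k] by linarith
      qed
    qed
    then show ?thesis
      using M2(1) by (intro exI[of _ 2] exI[of _ M2] conjI) (auto simp: decay_def \<phi>_def log_dist_def d_def)
  qed
  with \<tau> W(1) psh_continuous[OF W(1)] psh_imp_plurisubharmonic_on[OF W(1)] show ?thesis
    by blast
qed

end
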